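(* Let $p>2$ be a prime and let $G$ be a finite $p$-group. Assume $G$ admits a subnormal series $G=G_0>G_1>\cdots>G_{r-1}>G_r=1$ with $r\ge 1$, $G_i\trianglelefteq G_{i-1}$ and $Q_i=G_{i-1}/G_i$ for $i=1,\dots,r$, such that every $Q_i$ is a powerful $p$-group. Then $$\exp \mathrm{M}(G)\quad\text{divides}\quad \prod_{j=2}^{r}\exp Q_j\cdot\exp \mathrm{M}(Q_1).$$
   Context: $\mathrm{M}(G)=H^2(G,\mathbb{C}^\times)$ (trivial action) is the Schur multiplier of the finite group $G$; $\exp$ is the exponent. For $p>2$, a finite $p$-group $P$ is powerful if its derived subgroup satisfies $P'\le\mho(P)$, where $\mho(P)=\langle g^p\mid g\in P\rangle$. *)

theory Defs
  imports Complex_Main "HOL-Computational_Algebra.Primes" "HOL-Algebra.Product_Groups"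
begin

text \<open>The exponent of a group, with the convention that it is \<open>0\<close> if the group has no finite
  exponent (which never happens for finite groups).\<close>

definition group_exponent :: "('a, 'b) monoid_scheme \<Rightarrow> nat" where
  "group_exponent G =
    (if \<exists>n::nat. 0 < n \<and> (\<forall>x\<in>carrier G. x [^]\<^bsub>G\<^esub> n = \<one>\<^bsub>G\<^esub>)
     then LEAST n::nat. 0 < n \<and> (\<forall>x\<in>carrier G. x [^]\<^bsub>G\<^esub> n = \<one>\<^bsub>G\<^esub>)
     else 0)"

definition finite_p_group :: "nat \<Rightarrow> ('a, 'b) monoid_scheme \<Rightarrow> bool" where
  "finite_p_group p G \<longleftrightarrow> group G \<and> finite (carrier G) \<and> (\<exists>n. order G = p ^ n)"

definition agemo :: "nat \<Rightarrow> ('a, 'b) monoid_scheme \<Rightarrow> 'a set" where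
  "agemo p G = generate G {g [^]\<^bsub>G\<^esub> p |g. g \<in> carrier G}"

text \<open>This is the definition of powerful appropriate for odd \<open>p\<close>.\<close>

definition powerful_p_group :: "nat \<Rightarrow> ('a, 'b) monoid_scheme \<Rightarrow> bool" where
  "powerful_p_group p G \<longleftrightarrow> finite_p_group p G \<and> derived G (carrier G) \<subseteq> agemo p G"

definition subnormal_series :: "('a, 'b) monoid_scheme \<Rightarrow> (nat \<Rightarrow> 'a set) \<Rightarrow> nat \<Rightarrow> bool" where
  "subnormal_series G H r \<longleftrightarrow>
    H 0 = carrier G \<and> H r = {\<one>\<^bsub>G\<^esub>} \<and>
    (\<forall>i\<in>{1..r}. H i \<subset> H (i - 1) \<and> H i \<lhd> G\<lparr>carrier := H (i - 1)\<rparr>)"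

definition series_factor ::
    "('a, 'b) monoid_scheme \<Rightarrow> (nat \<Rightarrow> 'a set) \<Rightarrow> nat \<Rightarrow> 'a set monoid" where
  "series_factor G H i = G\<lparr>carrier := H (i - 1)\<rparr> Mod H i"

text \<open>Second cohomology of \<open>G\<close> with coefficients in an abelian group \<open>A\<close> on which \<open>G\<close> acts
  trivially, by inhomogeneous cochains. Cochains are extensional functions, multiplied pointwise.\<close>

definition cocycles2 :: "('a, 'c) monoid_scheme \<Rightarrow> ('b, 'd) monoid_scheme \<Rightarrow> ('a \<times> 'a \<Rightarrow> 'b) set"
  where
  "cocycles2 G A = {f \<in> carrier G \<times> carrier G \<rightarrow>\<^sub>E carrier A.
     \<forall>x\<in>carrier G. \<forall>y\<in>carrier G. \<forall>z\<in>carrier G.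
       f (y, z) \<otimes>\<^bsub>A\<^esub> f (x, y \<otimes>\<^bsub>G\<^esub> z) = f (x \<otimes>\<^bsub>G\<^esub> y, z) \<otimes>\<^bsub>A\<^esub> f (x, y)}"

definition coboundary2 ::
    "('a, 'c) monoid_scheme \<Rightarrow> ('b, 'd) monoid_scheme \<Rightarrow> ('a \<Rightarrow> 'b) \<Rightarrow> ('a \<times> 'a \<Rightarrow> 'b)" where
  "coboundary2 G A c = (\<lambda>(x, y) \<in> carrier G \<times> carrier G.
     c y \<otimes>\<^bsub>A\<^esub> inv\<^bsub>A\<^esub> (c (x \<otimes>\<^bsub>G\<^esub> y)) \<otimes>\<^bsub>A\<^esub> c x)"

definition coboundaries2 ::
    "('a, 'c) monoid_scheme \<Rightarrow> ('b, 'd) monoid_scheme \<Rightarrow> ('a \<times> 'a \<Rightarrow> 'b) set" where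
  "coboundaries2 G A = coboundary2 G A ` (carrier G \<rightarrow>\<^sub>E carrier A)"

definition cohomology2 ::
    "('a, 'c) monoid_scheme \<Rightarrow> ('b, 'd) monoid_scheme \<Rightarrow> ('a \<times> 'a \<Rightarrow> 'b) set monoid" where
  "cohomology2 G A =
     (product_group (carrier G \<times> carrier G) (\<lambda>_. A))\<lparr>carrier := cocycles2 G A\<rparr>
       Mod coboundaries2 G A"

definition complex_units :: "complex monoid" where
  "complex_units = \<lparr>carrier = - {0}, monoid.mult = (*), one = 1\<rparr>"

definition schur_multiplier :: "('a, 'b) monoid_scheme \<Rightarrow> ('a \<times> 'a \<Rightarrow> complex) set monoid" where
  "schur_multiplier G = cohomology2 G complex_units"

end

theory Submission
  imports Defs "HOL-Algebra.Group_Action" "HOL-Algebra.Multiplicative_Group"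
begin

text \<open>Let \<open>E\<close> be the central extension of \<open>G\<close> given by a cocycle \<open>f\<close>, and let \<open>n\<close> be the product of the
  exponents of the factors below \<open>H 1\<close>. On the preimage of \<open>H 1\<close> in \<open>E\<close> the map \<open>u \<mapsto> u\<^sup>n\<close> is a
  homomorphism into the central kernel of \<open>E\<close>; being invariant under conjugation by \<open>E\<close>, it exhibits
  \<open>f\<^sup>n\<close> as cohomologous to a cocycle inflated from \<open>G/H 1\<close>. That this power map is a homomorphism is
  shown by climbing the series: if the \<open>q\<close>-th power map is a homomorphism on \<open>B\<close>, and \<open>A \<ge> B\<close> has
  all its \<open>p\<close>-th powers and commutators in \<open>B\<close>, then the \<open>pq\<close>-th power map is one on \<open>A\<close>. A powerful
  factor of exponent \<open>p\<^sup>k\<close> is climbed in exactly \<open>k\<close> such steps, because its lower \<open>p\<close>-series has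
  length \<open>k\<close>.\<close>

section \<open>Power maps modulo the center\<close>

text \<open>A factor of exponent \<open>p^k\<close> is cut into sections of exponent
  \<open>p\<close> because over such a section nilpotency class 2 decides everything. Let
  \<open>K\<close> be the kernel of the \<open>q\<close>-th power map on \<open>B\<close>; then
  \<open>B\<close> is central modulo \<open>K\<close>. A commutator \<open>c\<close> of
  \<open>x\<close> and \<open>y\<close> lies in \<open>B\<close>, and so does \<open>y^p\<close>.
  Moving \<open>y^p\<close> past \<open>x\<close> produces \<open>c^p\<close>, so \<open>c^p\<close>
  is in \<open>K\<close>, and the commutator costs no further factor \<open>p\<close>. Oddness of
  \<open>p\<close> makes \<open>p\<close> divide the exponent \<open>p(p-1)/2\<close> of
  \<open>c\<close> in the collection formula.

  Each section costs one \<open>p\<close>, so the length of the series counts. A group of exponent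
  \<open>p^k\<close> has at least \<open>k\<close> such sections, and powerfulness makes the lower
  \<open>p\<close>-series attain \<open>k\<close>. This is proved by congruences: every element of
  term \<open>i\<close> is a \<open>p^i\<close>-th power modulo term \<open>i+1\<close>. For
  \<open>i = k\<close> the terms \<open>k\<close> and \<open>k+1\<close> agree, and in a finite
  \<open>p\<close>-group this series stops descending only at 1.

  The top factor is not climbed; it contributes the exponent of its own cohomology instead. The
  argument is carried out for an arbitrary abelian coefficient group with trivial action.\<close>

lemma (in group) group_exponent_dvd:
  assumes "0 < n" and pow: "\<And>x. x \<in> carrier G \<Longrightarrow> x [^] n = \<one>"
  shows "group_exponent G dvd n"
proof -
  define P where "P = (\<lambda>n::nat. 0 < n \<and> (\<forall>x\<in>carrier G. x [^] n = \<one>))"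
  define e where "e = (LEAST n. P n)"
  have ex: "P n" using assms by (simp add: P_def)
  then have "\<exists>n. P n" by blast
  then have e: "group_exponent G = e"
    unfolding group_exponent_def e_def P_def by (rule if_P)
  have Pe: "P e" unfolding e_def using ex by (rule LeastI)
  have "x [^] (n mod e) = \<one>" if "x \<in> carrier G" for x
  proof -
    have "x [^] n = (x [^] e) [^] (n div e) \<otimes> x [^] (n mod e)"
      using that by (metis nat_pow_mult nat_pow_pow nat_pow_closed mult_div_mod_eq)
    moreover have "x [^] n = \<one>" "x [^] e = \<one>" using that Pe pow by (auto simp: P_def)
    ultimately show ?thesis using that by simp
  qed
  moreover have "n mod e < e" using Pe by (simp add: P_def)
  ultimately have "n mod e = 0"
    using not_less_Least[of "n mod e" P] by (auto simp: P_def e_def)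
  then show ?thesis using e by auto
qed

text \<open>The default exponent 0 fits as well, since a zeroth power is the identity. The lemma can
  thus be applied to a cohomology group before its exponent is known to be positive.\<close>

lemma pow_group_exponent:
  assumes "x \<in> carrier G"
  shows "x [^]\<^bsub>G\<^esub> group_exponent G = \<one>\<^bsub>G\<^esub>"
proof (cases "\<exists>n::nat. 0 < n \<and> (\<forall>x\<in>carrier G. x [^]\<^bsub>G\<^esub> n = \<one>\<^bsub>G\<^esub>)")
  case True
  from LeastI_ex[OF this] True assms show ?thesis by (simp add: group_exponent_def)
next
  case False
  then show ?thesis by (simp only: group_exponent_def if_False nat_pow_0)
qed

lemma finite_p_group_exponent:
  assumes "prime p" "finite_p_group p G"
  obtains k where "group_exponent G = p ^ k"
proof -
  interpret group G using assms by (simp add: finite_p_group_def)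
  obtain n where n: "order G = p ^ n" using assms by (auto simp: finite_p_group_def)
  then have "group_exponent G dvd p ^ n"
    using pow_order_eq_1 assms(1) by (intro group_exponent_dvd) (auto simp: prime_gt_0_nat)
  with that show thesis using divides_primepow_nat[OF assms(1)] by blast
qed

section \<open>Words and powers in nilpotency class 2\<close>

lemma (in group) inv_mult_cancel:
  assumes "x \<in> carrier G" "y \<in> carrier G"
  shows "inv x \<otimes> (x \<otimes> y) = y" and "x \<otimes> (inv x \<otimes> y) = y"
  using assms by (simp_all flip: m_assoc)

text \<open>Oriented left to right, these equations decide the word problem of free groups.\<close>

lemmas (in group) word_simps = m_assoc inv_mult_group inv_mult_cancel

lemma (in group) conjugate_pow:
  assumes "x \<in> carrier G" "g \<in> carrier G"
  shows "(g \<otimes> x \<otimes> inv g) [^] (n::nat) = g \<otimes> x [^] n \<otimes> inv g"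
proof (induction n)
  case (Suc n)
  then show ?case using assms by (simp add: word_simps)
qed (use assms in simp)

text \<open>Here \<open>c\<close> is the commutator of \<open>y\<close> and \<open>x\<close>; moving
  \<open>x\<close> leftwards past each of the \<open>n\<close> copies of \<open>y\<close> releases
  one \<open>c\<close>, which commutes with the remaining copies.\<close>

lemma (in group) pow_swap_class2:
  assumes "x \<in> carrier G" "y \<in> carrier G" "c \<in> carrier G"
    and "y \<otimes> x = c \<otimes> (x \<otimes> y)" "c \<otimes> y = y \<otimes> c"
  shows "y [^] (n::nat) \<otimes> x = c [^] n \<otimes> (x \<otimes> y [^] n)"
proof (induction n)
  case (Suc n)
  have cy: "y [^] n \<otimes> c = c \<otimes> y [^] n"
    using group_commutes_pow[of y c n] assms by simp
  have "y [^] Suc n \<otimes> x = y [^] n \<otimes> (y \<otimes> x)" using assms by (simp add: m_assoc)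
  also have "\<dots> = y [^] n \<otimes> c \<otimes> (x \<otimes> y)" using assms by (simp add: m_assoc)
  also have "\<dots> = c \<otimes> (y [^] n \<otimes> x) \<otimes> y" unfolding cy using assms by (simp add: m_assoc)
  also have "\<dots> = c \<otimes> (c [^] n \<otimes> (x \<otimes> y [^] n)) \<otimes> y" by (simp add: Suc)
  also have "\<dots> = (c \<otimes> c [^] n) \<otimes> (x \<otimes> y [^] Suc n)" using assms by (simp add: m_assoc)
  also have "c \<otimes> c [^] n = c [^] Suc n" using assms nat_pow_Suc2[of c n] by simp
  finally show ?case .
qed (use assms in simp)

text \<open>The collection formula in class 2: in the word \<open>xyxy...xy\<close> there are
  \<open>n(n-1)/2\<close> pairs with a \<open>y\<close> before an \<open>x\<close>, and sorting
  releases one \<open>c\<close> for each.\<close>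

lemma (in group) mult_pow_class2:
  assumes "x \<in> carrier G" "y \<in> carrier G" "c \<in> carrier G"
    and "y \<otimes> x = c \<otimes> (x \<otimes> y)" "c \<otimes> y = y \<otimes> c" "c \<otimes> x = x \<otimes> c"
  shows "(x \<otimes> y) [^] (n::nat) = c [^] (n * (n - 1) div 2) \<otimes> (x [^] n \<otimes> y [^] n)"
proof (induction n)
  case (Suc n)
  have cx: "x [^] n \<otimes> c [^] n = c [^] n \<otimes> x [^] n"
    using group_commutes_pow[of x "c [^] n" n] group_commutes_pow[of c x n] assms by simp
  have e: "Suc n * (Suc n - 1) div 2 = n * (n - 1) div 2 + n"
    by (cases n) (auto simp: field_simps)
  let ?k = "n * (n - 1) div 2"
  have "(x \<otimes> y) [^] Suc n = c [^] ?k \<otimes> (x [^] n \<otimes> (y [^] n \<otimes> x) \<otimes> y)"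
    using assms Suc by (simp add: m_assoc)
  also have "\<dots> = c [^] ?k \<otimes> ((x [^] n \<otimes> c [^] n) \<otimes> (x \<otimes> y [^] n) \<otimes> y)"
    unfolding pow_swap_class2[OF assms(1-5)] using assms by (simp add: m_assoc)
  also have "\<dots> = (c [^] ?k \<otimes> c [^] n) \<otimes> (x [^] Suc n \<otimes> y [^] Suc n)"
    unfolding cx using assms by (simp add: m_assoc)
  finally show ?case using assms e by (simp add: nat_pow_mult)
qed (use assms in simp)

text \<open>For odd \<open>n\<close> the number \<open>n(n-1)/2\<close> is a multiple of
  \<open>n\<close>, so the commutator part vanishes. This is where \<open>p > 2\<close>
  enters.\<close>

lemma (in group) mult_pow_odd_class2:
  assumes "x \<in> carrier G" "y \<in> carrier G" "c \<in> carrier G"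
    and "y \<otimes> x = c \<otimes> (x \<otimes> y)" "c \<otimes> y = y \<otimes> c" "c \<otimes> x = x \<otimes> c"
    and "odd n" "c [^] n = \<one>"
  shows "(x \<otimes> y) [^] (n::nat) = x [^] n \<otimes> y [^] n"
proof -
  obtain m where "n = 2 * m + 1" using \<open>odd n\<close> by (rule oddE)
  then have "n * (n - 1) div 2 = n * m" by simp
  then have "c [^] (n * (n - 1) div 2) = \<one>"
    using assms by (simp flip: nat_pow_pow)
  then show ?thesis using mult_pow_class2[OF assms(1-6)] assms by simp
qed

text \<open>Presents \<open>G Mod N\<close> as an abstract image under \<open>h\<close>, so that
  congruences modulo \<open>N\<close> become equations between values of \<open>h\<close>. The
  counting clause is used to recognise quotients of \<open>p\<close>-groups as
  \<open>p\<close>-groups.\<close>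

lemma (in group) obtain_quotient:
  assumes "N \<lhd> G"
  obtains Q :: "'a set monoid" and h
  where "group_hom G Q h" "carrier Q = h ` carrier G"
    "\<And>x. x \<in> carrier G \<Longrightarrow> h x = \<one>\<^bsub>Q\<^esub> \<longleftrightarrow> x \<in> N"
    "card (carrier Q) * card N = order G"
proof -
  interpret normal N G by fact
  have "group_hom G (G Mod N) ((#>) N)"
    by (simp add: group_hom_def group_hom_axioms_def factorgroup_is_group r_coset_hom_Mod is_group)
  moreover have "N #> x = N \<longleftrightarrow> x \<in> N" if "x \<in> carrier G" for x
    using coset_join1 coset_join2 that subset is_subgroup by blast
  moreover have "card (carrier (G Mod N)) * card N = order G"
    using lagrange[OF is_subgroup] by (simp add: FactGroup_def)
  ultimately show thesis by (intro that[of "G Mod N" "(#>) N"]) (auto simp: carrier_FactGroup)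
qed

lemma (in group_hom) hom_eq_iff:
  assumes "x \<in> carrier G" "y \<in> carrier G"
  shows "h x = h y \<longleftrightarrow> h (x \<otimes> inv y) = \<one>\<^bsub>H\<^esub>"
  using assms H.inv_solve_right'[of "\<one>\<^bsub>H\<^esub>" "h x" "h y"] by simp

lemma (in group_hom) hom_commutator_eq_one_iff:
  assumes "x \<in> carrier G" "y \<in> carrier G"
  shows "h (x \<otimes> y \<otimes> inv x \<otimes> inv y) = \<one>\<^bsub>H\<^esub> \<longleftrightarrow> h x \<otimes>\<^bsub>H\<^esub> h y = h y \<otimes>\<^bsub>H\<^esub> h x"
  using assms hom_eq_iff[of "x \<otimes> y" "y \<otimes> x"] by (simp add: G.word_simps)

text \<open>The collection formula as a congruence modulo the kernel of \<open>h\<close>: class 2 is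
  demanded of the images only.\<close>

lemma (in group_hom) hom_mult_pow_odd:
  assumes "x \<in> carrier G" "y \<in> carrier G" "odd n"
    and c: "c = y \<otimes> x \<otimes> inv y \<otimes> inv x"
    and comm: "h c \<otimes>\<^bsub>H\<^esub> h x = h x \<otimes>\<^bsub>H\<^esub> h c" "h c \<otimes>\<^bsub>H\<^esub> h y = h y \<otimes>\<^bsub>H\<^esub> h c"
    and pow: "h (c [^] n) = \<one>\<^bsub>H\<^esub>"
  shows "h ((x \<otimes> y) [^] (n::nat)) = h (x [^] n) \<otimes>\<^bsub>H\<^esub> h (y [^] n)"
proof -
  have cG: "c \<in> carrier G" using assms by simp
  have "y \<otimes> x = c \<otimes> (x \<otimes> y)" using assms(1,2) by (simp add: c G.word_simps)
  then have "h (y \<otimes> x) = h (c \<otimes> (x \<otimes> y))" by simp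
  then show ?thesis
    using H.mult_pow_odd_class2[of "h x" "h y" "h c" n] assms(1-3) cG pow comm
    by (simp add: hom_nat_pow)
qed

text \<open>Modulo the kernel of the \<open>q\<close>-th power map on \<open>B\<close>, the subgroup \<open>B\<close> is central, so that \<open>G\<close>
  becomes nilpotent of class 2 and the \<open>p\<close>-th power map becomes a homomorphism.\<close>

lemma (in group) power_hom_step:
  assumes "odd p" and B: "subgroup B G"
    and central: "\<And>z g. z \<in> Z \<Longrightarrow> g \<in> carrier G \<Longrightarrow> z \<otimes> g = g \<otimes> z"
    and pow: "\<And>x. x \<in> carrier G \<Longrightarrow> x [^] p \<in> B"
    and comm: "\<And>x y. x \<in> carrier G \<Longrightarrow> y \<in> carrier G \<Longrightarrow> x \<otimes> y \<otimes> inv x \<otimes> inv y \<in> B"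
    and hom: "(\<lambda>x. x [^] q) \<in> hom (G\<lparr>carrier := B\<rparr>) (G\<lparr>carrier := Z\<rparr>)"
  shows "(\<lambda>x. x [^] (p * q :: nat)) \<in> hom G (G\<lparr>carrier := Z\<rparr>)"
proof -
  interpret B: subgroup B G by fact
  have powZ: "b [^] q \<in> Z" if "b \<in> B" for b using hom that by (auto simp: hom_def)
  have mult: "(b \<otimes> b') [^] q = b [^] q \<otimes> b' [^] q" if "b \<in> B" "b' \<in> B" for b b'
    using hom that by (auto simp: hom_def)
  \<comment> \<open>The \<open>q\<close>-th power of the conjugate is the conjugate of
    \<open>b^q\<close>, and \<open>b^q\<close> lies in the central set \<open>Z\<close>.\<close>
  have invar: "(g \<otimes> b \<otimes> inv g) [^] q = b [^] q" if "b \<in> B" "g \<in> carrier G" for b g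
  proof -
    have "(g \<otimes> b \<otimes> inv g) [^] q = b [^] q \<otimes> g \<otimes> inv g"
      using that conjugate_pow[of b g q] central[OF powZ[OF that(1)] that(2)] by simp
    then show ?thesis using that by (simp add: m_assoc)
  qed
  have invB: "inv b [^] q = inv (b [^] q)" if "b \<in> B" for b
    using that by (simp add: nat_pow_inv)
  define K where "K = {b \<in> B. b [^] q = \<one>}"
  \<comment> \<open>\<open>B\<close> is normal because it contains all commutators.\<close>
  have conjB: "g \<otimes> b \<otimes> inv g \<in> B" if "b \<in> B" "g \<in> carrier G" for b g
  proof -
    have "g \<otimes> b \<otimes> inv g = (g \<otimes> b \<otimes> inv g \<otimes> inv b) \<otimes> b" using that by (simp add: word_simps)
    then show ?thesis using comm[of g b] that B.m_closed by (metis B.mem_carrier)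
  qed
  have "K \<lhd> G"
  proof (rule normal_invI)
    show "subgroup K G"
      by (rule subgroupI) (use mult invB in \<open>auto simp: K_def intro!: exI[of _ \<one>]\<close>)
    show "g \<otimes> b \<otimes> inv g \<in> K" if "g \<in> carrier G" "b \<in> K" for g b
      using that invar conjB by (simp add: K_def)
  qed
  then obtain Q :: "'a set monoid" and h where h: "group_hom G Q h"
    and ker: "\<And>x. x \<in> carrier G \<Longrightarrow> h x = \<one>\<^bsub>Q\<^esub> \<longleftrightarrow> x \<in> K"
    using obtain_quotient by metis
  interpret h: group_hom G Q h by fact
  \<comment> \<open>The commutator is the product of \<open>b\<close> and a conjugate of
    \<open>inv b\<close>, both in \<open>B\<close>. By \<open>invar\<close> their
    \<open>q\<close>-th powers cancel, so \<open>B\<close> is central modulo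
    \<open>K\<close>.\<close>
  have BK: "b \<otimes> g \<otimes> inv b \<otimes> inv g \<in> K" if "b \<in> B" "g \<in> carrier G" for b g
  proof -
    have "b \<otimes> g \<otimes> inv b \<otimes> inv g = b \<otimes> (g \<otimes> inv b \<otimes> inv g)"
      using that by (simp add: m_assoc)
    also have "\<dots> [^] q = \<one>"
      using that mult conjB invar invB by simp
    finally show ?thesis using that comm by (simp add: K_def)
  qed
  have hB: "h b \<otimes>\<^bsub>Q\<^esub> h g = h g \<otimes>\<^bsub>Q\<^esub> h b" if "b \<in> B" "g \<in> carrier G" for b g
    using h.hom_commutator_eq_one_iff[of b g] ker[of "b \<otimes> g \<otimes> inv b \<otimes> inv g"] BK[OF that] that
    by (metis B.mem_carrier inv_closed m_closed)
  show ?thesis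
  proof (rule homI)
    fix x assume x: "x \<in> carrier G"
    then show "x [^] (p * q) \<in> carrier (G\<lparr>carrier := Z\<rparr>)"
      using powZ[OF pow] by (simp flip: nat_pow_pow)
  next
    fix x y assume x: "x \<in> carrier G" and y: "y \<in> carrier G"
    define c where "c = y \<otimes> x \<otimes> inv y \<otimes> inv x"
    have c: "c \<in> B" using comm x y by (simp add: c_def)
    have "y \<otimes> x = c \<otimes> (x \<otimes> y)" using x y by (simp add: c_def word_simps)
    then have "h (y \<otimes> x) = h (c \<otimes> (x \<otimes> y))" by simp
    \<comment> \<open>The image of \<open>y^p\<close> is moved past that of \<open>x\<close> in two
      ways: through the collection formula, which leaves \<open>c^p\<close>, and freely, because
      \<open>y^p\<close> lies in \<open>B\<close>. Comparison gives that \<open>c^p\<close> is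
      trivial modulo \<open>K\<close>.\<close>
    then have "h y [^]\<^bsub>Q\<^esub> p \<otimes>\<^bsub>Q\<^esub> h x = h c [^]\<^bsub>Q\<^esub> p \<otimes>\<^bsub>Q\<^esub> (h x \<otimes>\<^bsub>Q\<^esub> h y [^]\<^bsub>Q\<^esub> p)"
      using h.H.pow_swap_class2[of "h x" "h y" "h c" p] x y c hB[OF c] by simp
    moreover have "h y [^]\<^bsub>Q\<^esub> p \<otimes>\<^bsub>Q\<^esub> h x = h x \<otimes>\<^bsub>Q\<^esub> h y [^]\<^bsub>Q\<^esub> p"
      using hB[OF pow[OF y] x] y by (simp add: h.hom_nat_pow)
    ultimately have "h (c [^] p) = \<one>\<^bsub>Q\<^esub>"
      using x y c by (simp add: h.hom_nat_pow)
    then have "h ((x \<otimes> y) [^] p) = h (x [^] p \<otimes> y [^] p)"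
      using h.hom_mult_pow_odd[OF x y \<open>odd p\<close> c_def hB[OF c x] hB[OF c y]] x y by simp
    then have "(x \<otimes> y) [^] p \<otimes> inv (x [^] p \<otimes> y [^] p) \<in> K"
      using x y h.hom_eq_iff ker[of "(x \<otimes> y) [^] p \<otimes> inv (x [^] p \<otimes> y [^] p)"]
      by (metis inv_closed m_closed nat_pow_closed)
    \<comment> \<open>Elements of \<open>K\<close> have trivial \<open>q\<close>-th power, so a
      congruence modulo \<open>K\<close> between elements of \<open>B\<close> becomes an equation
      between their \<open>q\<close>-th powers.\<close>
    then have "((x \<otimes> y) [^] p \<otimes> inv (x [^] p \<otimes> y [^] p)) [^] q = \<one>" by (simp add: K_def)
    then have "((x \<otimes> y) [^] p) [^] q \<otimes> inv ((x [^] p \<otimes> y [^] p) [^] q) = \<one>"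
      using pow x y mult invB by simp
    then have "((x \<otimes> y) [^] p) [^] q = (x [^] p \<otimes> y [^] p) [^] q"
      using x y inv_solve_right'[of "\<one>" "((x \<otimes> y) [^] p) [^] q" "(x [^] p \<otimes> y [^] p) [^] q"] by simp
    then show "(x \<otimes> y) [^] (p * q) = x [^] (p * q) \<otimes>\<^bsub>G\<lparr>carrier := Z\<rparr>\<^esub> y [^] (p * q)"
      using x y pow mult by (simp add: nat_pow_pow)
  qed
qed

section \<open>The lower exponent-\<open>p\<close> central series\<close>

lemma (in group) finite_p_group_central_element:
  assumes "prime p" "finite_p_group p G" "carrier G \<noteq> {\<one>}"
  obtains c where "c \<in> carrier G" "c \<noteq> \<one>" "c [^] p = \<one>"
    "\<And>g. g \<in> carrier G \<Longrightarrow> c \<otimes> g = g \<otimes> c"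
proof -
  have fin: "finite (carrier G)" using assms by (simp add: finite_p_group_def)
  obtain n where n: "order G = p ^ n" using assms by (auto simp: finite_p_group_def)
  define conj where "conj = (\<lambda>g. \<lambda>h \<in> carrier G. g \<otimes> h \<otimes> inv g)"
  interpret act: group_action G "carrier G" conj
    unfolding conj_def by (rule action_by_conjugation)
  have "n \<noteq> 0" using n assms(3) order_one_triv_iff by auto
  have central: "x \<otimes> g = g \<otimes> x" if "x \<in> carrier G" "g \<in> carrier G" "orbit G conj x = {x}" for x g
  proof -
    have "g \<otimes> x \<otimes> inv g \<in> orbit G conj x"
      using that(1,2) by (auto simp: orbit_def conj_def intro!: exI[of _ g])
    then have "g \<otimes> x \<otimes> inv g = x" using that by auto
    then show ?thesis using that inv_solve_right'[of x "g \<otimes> x" g] by simp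
  qed
  have orbit_one: "orbit G conj \<one> = {\<one>}"
    by (auto simp: orbit_def conj_def intro!: exI[of _ \<one>])
  \<comment> \<open>The size of an orbit divides the group order and is therefore a power of
    \<open>p\<close>; if it is not 1, it is a multiple of \<open>p\<close>.\<close>
  have dvd_orbit: "p dvd card (orbit G conj x)" if "x \<in> carrier G" "orbit G conj x \<noteq> {x}" for x
  proof -
    have x: "x \<in> orbit G conj x" using act.orbit_refl that by simp
    have "card (orbit G conj x) dvd p ^ n"
      using act.orbit_stabilizer_theorem[OF that(1)] n by (metis dvd_triv_left)
    then obtain k where k: "card (orbit G conj x) = p ^ k"
      using divides_primepow_nat[OF assms(1)] by blast
    have "k \<noteq> 0"
    proof
      assume "k = 0"
      then obtain z where "orbit G conj x = {z}" using k by (auto simp: card_1_singleton_iff)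
      then show False using x that by auto
    qed
    then show ?thesis using k by simp
  qed
  have "\<exists>x \<in> carrier G - {\<one>}. orbit G conj x = {x}"
  proof (rule ccontr)
    \<comment> \<open>If the identity were the only fixed point, the other orbits would partition
      the remaining elements into blocks of size divisible by \<open>p\<close>, so \<open>p\<close>
      would divide both \<open>order G\<close> and \<open>order G - 1\<close>.\<close>
    assume *: "\<not> ?thesis"
    let ?C = "orbits G (carrier G) conj - {{\<one>}}"
    have orb: "{\<one>} \<in> orbits G (carrier G) conj"
      using orbit_one by (auto simp: orbits_def intro!: exI[of _ \<one>])
    have Un: "\<Union>?C = carrier G - {\<one>}"
    proof (intro equalityI subsetI)
      fix x assume "x \<in> \<Union>?C"
      then show "x \<in> carrier G - {\<one>}"
        using act.orbits_coverture act.disjoint_union[OF orb] by blast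
    next
      fix x assume "x \<in> carrier G - {\<one>}"
      then show "x \<in> \<Union>?C" using act.orbits_coverture by blast
    qed
    have "p dvd card (\<Union>?C)"
    proof (rule dvd_partition)
      show "finite (\<Union>?C)" unfolding Un using fin by simp
      show "\<forall>c\<in>?C. p dvd card c"
      proof
        fix c assume c: "c \<in> ?C"
        then obtain x where x: "x \<in> carrier G" "c = orbit G conj x" by (auto simp: orbits_def)
        with c orbit_one have "x \<noteq> \<one>" by auto
        then show "p dvd card c" using x * dvd_orbit by blast
      qed
      show "\<forall>c1\<in>?C. \<forall>c2\<in>?C. c1 \<noteq> c2 \<longrightarrow> c1 \<inter> c2 = {}"
        using act.disjoint_union by blast
    qed
    then have "p dvd order G - 1" unfolding Un using fin by (simp add: order_def)
    moreover have "p dvd order G" using n \<open>n \<noteq> 0\<close> by simp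
    moreover have "order G > 0" using fin order_gt_0_iff_finite by simp
    ultimately have "p dvd 1"
      by (metis One_nat_def Suc_pred add.commute dvd_add_right_iff plus_1_eq_Suc)
    then show False using assms(1) by (simp add: prime_nat_iff)
  qed
  then obtain x where x: "x \<in> carrier G" "x \<noteq> \<one>" "orbit G conj x = {x}" by auto
  have "x [^] (p ^ n) = \<one>" using pow_order_eq_1[OF x(1)] n by simp
  then have ex: "\<exists>m. x [^] (p ^ m) = \<one>" by blast
  \<comment> \<open>The last nontrivial element among the iterated \<open>p\<close>-th powers of the
    central \<open>x\<close> has order \<open>p\<close>; \<open>m\<close> is positive because
    \<open>x\<close> is not the identity.\<close>
  define m where "m = (LEAST m. x [^] (p ^ m) = \<one>)"
  have m: "x [^] (p ^ m) = \<one>" unfolding m_def using ex by (rule LeastI_ex)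
  then have "m \<noteq> 0" using x by (intro notI) simp
  then obtain k where k: "m = Suc k" using not0_implies_Suc by blast
  define c where "c = x [^] (p ^ k)"
  have "c \<noteq> \<one>" using not_less_Least[of k "\<lambda>m. x [^] (p ^ m) = \<one>"] k by (simp add: c_def m_def)
  moreover have "c [^] p = \<one>"
    using m x by (simp add: c_def k nat_pow_pow mult.commute)
  moreover have "c \<otimes> g = g \<otimes> c" if "g \<in> carrier G" for g
    unfolding c_def using group_commutes_pow[of x g "p ^ k"] central x that by simp
  ultimately show thesis using that[of c] x by (simp add: c_def)
qed

text \<open>The subgroup usually written \<open>N^p [N,G]\<close>. For normal \<open>N\<close> it is
  the smallest one modulo which \<open>N\<close> becomes central and of exponent dividing
  \<open>p\<close>.\<close>

definition lower_p_step :: "nat \<Rightarrow> ('a, 'b) monoid_scheme \<Rightarrow> 'a set \<Rightarrow> 'a set" where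
  "lower_p_step p G N = generate G
    ({x [^]\<^bsub>G\<^esub> p | x. x \<in> N} \<union>
     {x \<otimes>\<^bsub>G\<^esub> g \<otimes>\<^bsub>G\<^esub> inv\<^bsub>G\<^esub> x \<otimes>\<^bsub>G\<^esub> inv\<^bsub>G\<^esub> g | x g. x \<in> N \<and> g \<in> carrier G})"

text \<open>Counting starts at 0, so that term \<open>i\<close> matches \<open>p^i\<close>-th powers
  and exponent \<open>p^k\<close> will force term \<open>k\<close> to be trivial.\<close>

primrec lower_p_series :: "nat \<Rightarrow> ('a, 'b) monoid_scheme \<Rightarrow> nat \<Rightarrow> 'a set" where
  "lower_p_series p G 0 = carrier G" |
  "lower_p_series p G (Suc i) = lower_p_step p G (lower_p_series p G i)"

lemma (in group) lower_p_step_pow: "x \<in> N \<Longrightarrow> x [^] p \<in> lower_p_step p G N"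
  by (auto simp: lower_p_step_def intro: generate.incl)

lemma (in group) lower_p_step_commutator:
  "x \<in> N \<Longrightarrow> g \<in> carrier G \<Longrightarrow> x \<otimes> g \<otimes> inv x \<otimes> inv g \<in> lower_p_step p G N"
  by (auto simp: lower_p_step_def intro: generate.incl)

lemma (in group) lower_p_step_least:
  assumes "subgroup L G" "\<And>x. x \<in> N \<Longrightarrow> x [^] p \<in> L"
    "\<And>x g. x \<in> N \<Longrightarrow> g \<in> carrier G \<Longrightarrow> x \<otimes> g \<otimes> inv x \<otimes> inv g \<in> L"
  shows "lower_p_step p G N \<subseteq> L"
  unfolding lower_p_step_def using assms by (intro generate_subgroup_incl) auto

lemma (in group) lower_p_step_mono:
  assumes "M \<subseteq> N"
  shows "lower_p_step p G M \<subseteq> lower_p_step p G N"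
  unfolding lower_p_step_def using assms by (intro mono_generate) blast

text \<open>The generating set is already invariant under conjugation, which carries powers to
  powers and commutators to commutators of conjugates.\<close>

lemma (in group) lower_p_step_normal:
  assumes "N \<lhd> G"
  shows "lower_p_step p G N \<lhd> G"
proof -
  interpret normal N G by fact
  show ?thesis
    unfolding lower_p_step_def
  proof (rule normal_generateI)
    fix h g
    assume g: "g \<in> carrier G" and "h \<in> {x [^] p | x. x \<in> N} \<union>
      {x \<otimes> g \<otimes> inv x \<otimes> inv g | x g. x \<in> N \<and> g \<in> carrier G}"
    then consider x where "x \<in> N" "h = x [^] p"
      | x y where "x \<in> N" "y \<in> carrier G" "h = x \<otimes> y \<otimes> inv x \<otimes> inv y" by blast
    then show "g \<otimes> h \<otimes> inv g \<in> {x [^] p | x. x \<in> N} \<union>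
      {x \<otimes> g \<otimes> inv x \<otimes> inv g | x g. x \<in> N \<and> g \<in> carrier G}"
    proof cases
      case 1
      then have "g \<otimes> h \<otimes> inv g = (g \<otimes> x \<otimes> inv g) [^] p" using g conjugate_pow by simp
      then show ?thesis using 1 g inv_op_closed2 by blast
    next
      case 2
      let ?x = "g \<otimes> x \<otimes> inv g" and ?y = "g \<otimes> y \<otimes> inv g"
      have "g \<otimes> h \<otimes> inv g = ?x \<otimes> ?y \<otimes> inv ?x \<otimes> inv ?y"
        using 2 g by (simp add: word_simps)
      moreover have "?x \<in> N" "?y \<in> carrier G" using 2 g inv_op_closed2 by auto
      ultimately show ?thesis by blast
    qed
  qed auto
qed

lemma (in group) lower_p_series_normal: "lower_p_series p G i \<lhd> G"
  by (induction i) (simp_all add: normal_self lower_p_step_normal)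

lemma (in group) lower_p_series_subgroup: "subgroup (lower_p_series p G i) G"
  using lower_p_series_normal normal_imp_subgroup by blast

lemma (in group) lower_p_series_decreasing:
  "lower_p_series p G (Suc i) \<subseteq> lower_p_series p G i"
proof -
  interpret normal "lower_p_series p G i" G by (rule lower_p_series_normal)
  have "x \<otimes> g \<otimes> inv x \<otimes> inv g \<in> lower_p_series p G i"
    if "x \<in> lower_p_series p G i" "g \<in> carrier G" for x g
  proof -
    have "x \<otimes> g \<otimes> inv x \<otimes> inv g = x \<otimes> (g \<otimes> inv x \<otimes> inv g)" using that by (simp add: m_assoc)
    then show ?thesis using that inv_op_closed2[of g "inv x"] by simp
  qed
  moreover have "x [^] p \<in> lower_p_series p G i" if "x \<in> lower_p_series p G i" for x
    using subgroup_int_pow_closed[OF is_subgroup that, of "int p"] by (simp add: int_pow_int)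
  ultimately show ?thesis
    using lower_p_step_least[OF is_subgroup] by simp
qed

text \<open>A proper normal subgroup \<open>L\<close> is enlarged by the preimage of the elements of order dividing
  \<open>p\<close> in the center of the quotient by \<open>L\<close>; one step of the series descends from there to \<open>L\<close>.\<close>

lemma (in group) lower_p_series_subset_normal:
  assumes "prime p" "finite_p_group p G" "L \<lhd> G"
  shows "\<exists>j. lower_p_series p G j \<subseteq> L"
  using assms(3)
\<comment> \<open>The induction runs upwards, on the number of elements outside \<open>L\<close>; it
  ends at the whole group, where term 0 is contained in \<open>L\<close>.\<close>
proof (induction "card (carrier G) - card L" arbitrary: L rule: less_induct)
  case less
  interpret L: normal L G by fact
  have fin: "finite (carrier G)" using assms by (simp add: finite_p_group_def)
  obtain n where n: "order G = p ^ n" using assms by (auto simp: finite_p_group_def)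
  show ?case
  proof (cases "L = carrier G")
    case True
    then show ?thesis by (intro exI[of _ 0]) simp
  next
    case False
    obtain Q :: "'a set monoid" and h where h: "group_hom G Q h"
      and surj: "carrier Q = h ` carrier G"
      and ker: "\<And>x. x \<in> carrier G \<Longrightarrow> h x = \<one>\<^bsub>Q\<^esub> \<longleftrightarrow> x \<in> L"
      and card: "card (carrier Q) * card L = order G"
      using obtain_quotient[OF less.prems] by metis
    interpret h: group_hom G Q h by fact
    have "card (carrier Q) dvd p ^ n" using card n by (metis dvd_triv_left)
    then obtain k where "card (carrier Q) = p ^ k"
      using divides_primepow_nat[OF assms(1)] by blast
    moreover have "finite (carrier Q)" unfolding surj using fin by (rule finite_imageI)
    ultimately have "finite_p_group p Q"
      unfolding finite_p_group_def order_def using h.H.is_group by blast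
    moreover have "carrier Q \<noteq> {\<one>\<^bsub>Q\<^esub>}"
    proof -
      obtain x where "x \<in> carrier G" "x \<notin> L" using False L.subset by blast
      then show ?thesis using ker[of x] h.hom_closed[of x] by fastforce
    qed
    ultimately obtain d where d: "d \<in> carrier Q" "d \<noteq> \<one>\<^bsub>Q\<^esub>" "d [^]\<^bsub>Q\<^esub> p = \<one>\<^bsub>Q\<^esub>"
      "\<And>g. g \<in> carrier Q \<Longrightarrow> d \<otimes>\<^bsub>Q\<^esub> g = g \<otimes>\<^bsub>Q\<^esub> d"
      using h.H.finite_p_group_central_element[OF assms(1), of thesis] by blast
    define M where "M = {x \<in> carrier G. h x [^]\<^bsub>Q\<^esub> p = \<one>\<^bsub>Q\<^esub> \<and>
      (\<forall>g\<in>carrier Q. h x \<otimes>\<^bsub>Q\<^esub> g = g \<otimes>\<^bsub>Q\<^esub> h x)}"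
    have LM: "L \<subset> M"
    proof -
      have "x \<in> M" if "x \<in> L" for x
      proof -
        have x: "x \<in> carrier G" using that L.subset by blast
        then have "h x = \<one>\<^bsub>Q\<^esub>" using that ker by blast
        then show ?thesis using x by (simp add: M_def)
      qed
      then have "L \<subseteq> M" by blast
      \<comment> \<open>A preimage of the central element \<open>d\<close> of order \<open>p\<close>
        makes the inclusion strict, which drives the induction.\<close>
      moreover obtain x where x: "x \<in> carrier G" "h x = d" using d(1) surj by auto
      then have "x \<in> M" "x \<notin> L" using d ker[of x] by (simp_all add: M_def)
      ultimately show ?thesis by blast
    qed
    have "M \<lhd> G"
    proof (rule normal_invI)
      show "subgroup M G"
      proof (rule subgroupI)
        show "M \<subseteq> carrier G" by (auto simp: M_def)
        show "M \<noteq> {}" using LM by auto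
        fix x assume x: "x \<in> M"
        have "inv\<^bsub>Q\<^esub> h x \<otimes>\<^bsub>Q\<^esub> g = g \<otimes>\<^bsub>Q\<^esub> inv\<^bsub>Q\<^esub> h x" if "g \<in> carrier Q" for g
        proof -
          have X: "h x \<otimes>\<^bsub>Q\<^esub> g = g \<otimes>\<^bsub>Q\<^esub> h x" "h x \<in> carrier Q" using x that by (auto simp: M_def)
          then have "g = (h x \<otimes>\<^bsub>Q\<^esub> g) \<otimes>\<^bsub>Q\<^esub> inv\<^bsub>Q\<^esub> h x"
            using that by (simp add: h.H.m_assoc)
          also have "\<dots> = h x \<otimes>\<^bsub>Q\<^esub> (g \<otimes>\<^bsub>Q\<^esub> inv\<^bsub>Q\<^esub> h x)" using X(2) that by (intro h.H.m_assoc) auto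
          finally show ?thesis
            using X that h.H.inv_solve_left[of "g \<otimes>\<^bsub>Q\<^esub> inv\<^bsub>Q\<^esub> h x" "h x" g] by simp
        qed
        then show "inv x \<in> M" using x by (simp add: M_def h.H.nat_pow_inv)
        fix y assume y: "y \<in> M"
        have X: "h x \<in> carrier Q" "h y \<in> carrier Q" using x y by (auto simp: M_def)
        have pow: "(h x \<otimes>\<^bsub>Q\<^esub> h y) [^]\<^bsub>Q\<^esub> p = \<one>\<^bsub>Q\<^esub>"
        proof -
          have "h x \<otimes>\<^bsub>Q\<^esub> h y = h y \<otimes>\<^bsub>Q\<^esub> h x" "h x [^]\<^bsub>Q\<^esub> p = \<one>\<^bsub>Q\<^esub>" "h y [^]\<^bsub>Q\<^esub> p = \<one>\<^bsub>Q\<^esub>"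
            using x y X(2) unfolding M_def mem_Collect_eq by blast+
          then show ?thesis using h.H.pow_mult_distrib[OF _ X, of p] by simp
        qed
        have "h x \<otimes>\<^bsub>Q\<^esub> h y \<otimes>\<^bsub>Q\<^esub> g = g \<otimes>\<^bsub>Q\<^esub> (h x \<otimes>\<^bsub>Q\<^esub> h y)" if "g \<in> carrier Q" for g
        proof -
          have "h x \<otimes>\<^bsub>Q\<^esub> h y \<otimes>\<^bsub>Q\<^esub> g = h x \<otimes>\<^bsub>Q\<^esub> (h y \<otimes>\<^bsub>Q\<^esub> g)"
            using X that by (intro h.H.m_assoc)
          also have "h y \<otimes>\<^bsub>Q\<^esub> g = g \<otimes>\<^bsub>Q\<^esub> h y" using y that by (simp only: M_def mem_Collect_eq)
          also have "h x \<otimes>\<^bsub>Q\<^esub> (g \<otimes>\<^bsub>Q\<^esub> h y) = h x \<otimes>\<^bsub>Q\<^esub> g \<otimes>\<^bsub>Q\<^esub> h y"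
            using X that by (intro h.H.m_assoc[symmetric])
          also have "h x \<otimes>\<^bsub>Q\<^esub> g = g \<otimes>\<^bsub>Q\<^esub> h x" using x that by (simp only: M_def mem_Collect_eq)
          also have "g \<otimes>\<^bsub>Q\<^esub> h x \<otimes>\<^bsub>Q\<^esub> h y = g \<otimes>\<^bsub>Q\<^esub> (h x \<otimes>\<^bsub>Q\<^esub> h y)"
            using X that by (intro h.H.m_assoc)
          finally show ?thesis .
        qed
        moreover have G: "x \<in> carrier G" "y \<in> carrier G" using x y by (simp_all add: M_def)
        ultimately show "x \<otimes> y \<in> M"
          unfolding M_def mem_Collect_eq h.hom_mult[OF G] using pow G by (intro conjI ballI m_closed)
      qed
      fix g x assume g: "g \<in> carrier G" and x: "x \<in> M"
      then have "h (g \<otimes> x \<otimes> inv g) = h x"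
        using h.H.inv_solve_right'[of "h x" "h g \<otimes>\<^bsub>Q\<^esub> h x" "h g"] by (simp add: M_def)
      then show "g \<otimes> x \<otimes> inv g \<in> M" using g x by (simp add: M_def)
    qed
    moreover have "card L < card M" "card M \<le> card (carrier G)"
      using LM \<open>M \<lhd> G\<close> fin normal_imp_subgroup[THEN subgroup.subset]
      by (metis psubset_card_mono finite_subset, metis card_mono)
    ultimately obtain j where j: "lower_p_series p G j \<subseteq> M"
      using less.hyps[OF diff_less_mono2] by (meson order_less_le_trans)
    have "lower_p_step p G M \<subseteq> L"
    proof (rule lower_p_step_least[OF L.is_subgroup])
      fix x assume x: "x \<in> M"
      then show "x [^] p \<in> L" using ker[of "x [^] p"] by (simp add: M_def h.hom_nat_pow)
      fix g assume g: "g \<in> carrier G"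
      then show "x \<otimes> g \<otimes> inv x \<otimes> inv g \<in> L"
        using x ker[of "x \<otimes> g \<otimes> inv x \<otimes> inv g"] h.hom_commutator_eq_one_iff[of x g]
        by (simp add: M_def del: h.hom_mult)
    qed
    then have "lower_p_series p G (Suc j) \<subseteq> L"
      using lower_p_step_mono[OF j] by fastforce
    then show ?thesis by blast
  qed
qed

section \<open>Powers along the lower \<open>p\<close>-series of a powerful group\<close>

lemma (in group_hom) hom_mult_pow_lower_p_step:
  assumes "odd p" "x \<in> carrier G" "y \<in> carrier G" "y \<otimes>\<^bsub>G\<^esub> x \<otimes>\<^bsub>G\<^esub> inv\<^bsub>G\<^esub> y \<otimes>\<^bsub>G\<^esub> inv\<^bsub>G\<^esub> x \<in> M"
    and ker: "\<And>k. k \<in> lower_p_step p G M \<Longrightarrow> h k = \<one>\<^bsub>H\<^esub>"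
  shows "h ((x \<otimes>\<^bsub>G\<^esub> y) [^]\<^bsub>G\<^esub> p) = h (x [^]\<^bsub>G\<^esub> p) \<otimes>\<^bsub>H\<^esub> h (y [^]\<^bsub>G\<^esub> p)"
proof -
  define c where "c = y \<otimes>\<^bsub>G\<^esub> x \<otimes>\<^bsub>G\<^esub> inv\<^bsub>G\<^esub> y \<otimes>\<^bsub>G\<^esub> inv\<^bsub>G\<^esub> x"
  have c: "c \<in> M" "c \<in> carrier G" using assms by (simp_all add: c_def)
  \<comment> \<open>One step from \<open>M\<close> contains both the commutators of \<open>c\<close>
    with the group and \<open>c^p\<close>. If \<open>h\<close> kills that step, the image of
    \<open>c\<close> is central of order dividing \<open>p\<close>, as the collection formula
    requires.\<close>
  have "h c \<otimes>\<^bsub>H\<^esub> h g = h g \<otimes>\<^bsub>H\<^esub> h c" if "g \<in> carrier G" for g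
    using hom_commutator_eq_one_iff[OF c(2) that] ker[OF G.lower_p_step_commutator[OF c(1) that]] by simp
  moreover have "h (c [^]\<^bsub>G\<^esub> p) = \<one>\<^bsub>H\<^esub>" by (rule ker[OF G.lower_p_step_pow[OF c(1)]])
  ultimately show ?thesis using hom_mult_pow_odd[OF assms(2,3,1) c_def] assms(2,3) by simp
qed

text \<open>Commutators of elements of \<open>N\<close> lie one step below \<open>N\<close>, and
  \<open>h\<close> kills the step after that, so \<open>p\<close>-th powers of elements of
  \<open>N\<close> multiply as they should. Knowing that this set is a subgroup reduces later claims
  about a whole term of the series to its generators.\<close>

lemma (in group_hom) powers_mod_kernel_subgroup:
  assumes "odd p" "N \<lhd> G"
    and ker: "\<And>k. k \<in> lower_p_step p G (lower_p_step p G N) \<Longrightarrow> h k = \<one>\<^bsub>H\<^esub>"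
  shows "subgroup {d \<in> carrier G. \<exists>x\<in>N. h d = h (x [^]\<^bsub>G\<^esub> p)} G" (is "subgroup ?S G")
proof -
  interpret N: normal N G by fact
  show ?thesis
  proof (rule G.subgroupI)
    have "\<one>\<^bsub>G\<^esub> \<in> ?S" by (auto intro!: bexI[of _ "\<one>\<^bsub>G\<^esub>"])
    then show "?S \<noteq> {}" by blast
    fix a assume a: "a \<in> ?S"
    then obtain x where x: "x \<in> N" "h a = h (x [^]\<^bsub>G\<^esub> p)" by blast
    have "h (inv\<^bsub>G\<^esub> a) = h (inv\<^bsub>G\<^esub> x [^]\<^bsub>G\<^esub> p)" using a x by (simp add: G.nat_pow_inv)
    then show "inv\<^bsub>G\<^esub> a \<in> ?S" using a x by blast
    fix b assume b: "b \<in> ?S"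
    then obtain y where y: "y \<in> N" "h b = h (y [^]\<^bsub>G\<^esub> p)" by blast
    have "h ((x \<otimes>\<^bsub>G\<^esub> y) [^]\<^bsub>G\<^esub> p) = h (x [^]\<^bsub>G\<^esub> p) \<otimes>\<^bsub>H\<^esub> h (y [^]\<^bsub>G\<^esub> p)"
      using x y G.lower_p_step_commutator
      by (intro hom_mult_pow_lower_p_step[OF assms(1) _ _ _ ker]) auto
    then have "h (a \<otimes>\<^bsub>G\<^esub> b) = h ((x \<otimes>\<^bsub>G\<^esub> y) [^]\<^bsub>G\<^esub> p)" using a b x y by simp
    then show "a \<otimes>\<^bsub>G\<^esub> b \<in> ?S" using a b x y by blast
  qed auto
qed

text \<open>In a powerful group the \<open>p\<close>-th power map induces surjections between consecutive factors of the
  lower \<open>p\<close>-series.\<close>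

lemma (in group) powerful_lower_p_series_pow:
  assumes "odd p" "powerful_p_group p G" "d \<in> lower_p_series p G (Suc i)"
  shows "\<exists>x\<in>lower_p_series p G i. d \<otimes> inv (x [^] p) \<in> lower_p_series p G (Suc (Suc i))"
  using assms(3)
proof (induction i arbitrary: d)
  case 0
  obtain Q :: "'a set monoid" and h where h: "group_hom G Q h"
    and ker: "\<And>x. x \<in> carrier G \<Longrightarrow> h x = \<one>\<^bsub>Q\<^esub> \<longleftrightarrow> x \<in> lower_p_series p G 2"
    using obtain_quotient[OF lower_p_series_normal] by metis
  interpret h: group_hom G Q h by fact
  let ?S = "{d \<in> carrier G. \<exists>x\<in>carrier G. h d = h (x [^] p)}"
  have sub: "lower_p_series p G 2 \<subseteq> carrier G"
    using lower_p_series_subgroup subgroup.subset by blast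
  have S: "subgroup ?S G"
    by (rule h.powers_mod_kernel_subgroup[OF assms(1) normal_self])
      (use ker sub in \<open>auto simp: numeral_2_eq_2\<close>)
  \<comment> \<open>Powerfulness is used here only: \<open>agemo p G\<close> is generated by
    elements of \<open>?S\<close>, and it contains all commutators, so both kinds of generators of
    term 1 lie in \<open>?S\<close>.\<close>
  have "agemo p G \<subseteq> ?S"
    unfolding agemo_def by (rule generate_subgroup_incl[OF _ S]) blast
  moreover have "x \<otimes> g \<otimes> inv x \<otimes> inv g \<in> agemo p G" if "x \<in> carrier G" "g \<in> carrier G" for x g
    using that assms(2) generate.incl[of "x \<otimes> g \<otimes> inv x \<otimes> inv g" "derived_set G (carrier G)" G]
    unfolding powerful_p_group_def derived_def by blast
  ultimately have "lower_p_step p G (carrier G) \<subseteq> ?S"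
    by (intro lower_p_step_least[OF S]) blast+
  then obtain x where x: "d \<in> carrier G" "x \<in> carrier G" "h d = h (x [^] p)"
    using 0 by auto
  then have "d \<otimes> inv (x [^] p) \<in> lower_p_series p G 2"
    using h.hom_eq_iff[of d "x [^] p"] ker[of "d \<otimes> inv (x [^] p)"]
    by (metis inv_closed m_closed nat_pow_closed)
  then show ?case using x by (auto simp: numeral_2_eq_2)
next
  case (Suc i)
  let ?P = "lower_p_series p G"
  have sub: "?P j \<subseteq> carrier G" for j
    using lower_p_series_subgroup subgroup.subset by blast
  obtain Q :: "'a set monoid" and h where h: "group_hom G Q h"
    and ker: "\<And>x. x \<in> carrier G \<Longrightarrow> h x = \<one>\<^bsub>Q\<^esub> \<longleftrightarrow> x \<in> ?P (Suc (Suc (Suc i)))"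
    using obtain_quotient[OF lower_p_series_normal] by metis
  have ker': "h k = \<one>\<^bsub>Q\<^esub>" if "k \<in> lower_p_step p G (?P (Suc (Suc i)))" for k
    using ker[of k] that sub[of "Suc (Suc (Suc i))"] by auto
  interpret h: group_hom G Q h by fact
  let ?S = "{d \<in> carrier G. \<exists>x\<in>?P (Suc i). h d = h (x [^] p)}"
  have S: "subgroup ?S G"
    using ker' by (intro h.powers_mod_kernel_subgroup[OF assms(1) lower_p_series_normal]) auto
  have "lower_p_step p G (?P (Suc i)) \<subseteq> ?S"
  proof (rule lower_p_step_least[OF S])
    fix x assume x: "x \<in> ?P (Suc i)"
    then have xG: "x \<in> carrier G" using sub by blast
    then show "x [^] p \<in> ?S" using x by blast
    fix g assume g: "g \<in> carrier G"
    \<comment> \<open>The generator \<open>x^p\<close> is immediate, so the commutator of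
      \<open>x\<close> and \<open>g\<close> remains. By induction \<open>x = z y^p\<close> with
      \<open>z\<close> in term \<open>i+2\<close>, hence central modulo term \<open>i+3\<close>, so
      that \<open>x\<close> may be replaced by \<open>y^p\<close>. With \<open>d\<close> the
      commutator of \<open>y\<close> and \<open>g\<close>, the result will be congruent to
      \<open>d^p\<close>.\<close>
    obtain y where y: "y \<in> ?P i" and z: "x \<otimes> inv (y [^] p) \<in> ?P (Suc (Suc i))"
      using Suc.IH[OF x] by blast
    have yG: "y \<in> carrier G" using y sub by blast
    define z where "z = x \<otimes> inv (y [^] p)"
    have zG: "z \<in> carrier G" using xG yG by (simp add: z_def)
    have hz: "h z \<otimes>\<^bsub>Q\<^esub> h a = h a \<otimes>\<^bsub>Q\<^esub> h z" if "a \<in> carrier G" for a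
      using h.hom_commutator_eq_one_iff[OF zG that] that z
        ker'[OF lower_p_step_commutator[OF z[folded z_def] that]] by simp
    define d where "d = y \<otimes> g \<otimes> inv y \<otimes> inv g"
    have d: "d \<in> ?P (Suc i)" using lower_p_step_commutator[OF y g] by (simp add: d_def)
    have dG: "d \<in> carrier G" using yG g by (simp add: d_def)
    have "x = z \<otimes> y [^] p" using xG yG by (simp add: z_def m_assoc)
    then have "x \<otimes> g \<otimes> inv x \<otimes> inv g = z \<otimes> (y [^] p \<otimes> g \<otimes> inv (y [^] p)) \<otimes> inv z \<otimes> inv g"
      using zG yG g by (simp add: word_simps)
    then have "h (x \<otimes> g \<otimes> inv x \<otimes> inv g) = (h z \<otimes>\<^bsub>Q\<^esub> h (y [^] p \<otimes> g \<otimes> inv (y [^] p))) \<otimes>\<^bsub>Q\<^esub> inv\<^bsub>Q\<^esub> h z \<otimes>\<^bsub>Q\<^esub> inv\<^bsub>Q\<^esub> h g"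
      using zG yG g by simp
    also have "\<dots> = h (y [^] p \<otimes> g \<otimes> inv (y [^] p)) \<otimes>\<^bsub>Q\<^esub> h (inv g)"
      using zG yG g hz[of "y [^] p \<otimes> g \<otimes> inv (y [^] p)"] by (simp add: h.H.m_assoc)
    also have "\<dots> = h (y [^] p \<otimes> g \<otimes> inv (y [^] p) \<otimes> inv g)"
      using yG g by simp
    \<comment> \<open>The commutator of \<open>y^p\<close> and \<open>g\<close> is
      \<open>y^p\<close> times the \<open>p\<close>-th power of a conjugate of \<open>inv y\<close>,
      and that conjugate is \<open>inv y\<close> times \<open>d\<close>.\<close>
    also have "y [^] p \<otimes> g \<otimes> inv (y [^] p) \<otimes> inv g = y [^] p \<otimes> (g \<otimes> inv y \<otimes> inv g) [^] p"
    proof -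
      have "(g \<otimes> inv y \<otimes> inv g) [^] p = g \<otimes> inv (y [^] p) \<otimes> inv g"
        using yG g conjugate_pow[of "inv y" g p] by (simp add: nat_pow_inv)
      then show ?thesis using yG g by (simp add: m_assoc)
    qed
    also have "g \<otimes> inv y \<otimes> inv g = inv y \<otimes> d"
      using yG g by (simp add: d_def word_simps)
    also have "h (y [^] p \<otimes> (inv y \<otimes> d) [^] p) = h (y [^] p) \<otimes>\<^bsub>Q\<^esub> h ((inv y \<otimes> d) [^] p)"
      using yG dG by simp
    \<comment> \<open>Since \<open>d\<close> is in term \<open>i+1\<close>, its commutator with
      \<open>inv y\<close> is in term \<open>i+2\<close>, and the next step is killed by
      \<open>h\<close>. The power therefore splits, and \<open>y^p\<close> cancels against the power
      of \<open>inv y\<close>.\<close>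
    also have "h ((inv y \<otimes> d) [^] p) = h (inv y [^] p) \<otimes>\<^bsub>Q\<^esub> h (d [^] p)"
    proof (rule h.hom_mult_pow_lower_p_step[OF assms(1) _ dG _ ker'])
      show "d \<otimes> inv y \<otimes> inv d \<otimes> inv (inv y) \<in> ?P (Suc (Suc i))"
        using lower_p_step_commutator[OF d, of "inv y"] yG by simp
    qed (use yG in auto)
    also have "h (y [^] p) \<otimes>\<^bsub>Q\<^esub> (h (inv y [^] p) \<otimes>\<^bsub>Q\<^esub> h (d [^] p)) = h (d [^] p)"
      using yG dG by (simp add: nat_pow_inv h.H.inv_mult_cancel)
    finally show "x \<otimes> g \<otimes> inv x \<otimes> inv g \<in> ?S" using xG g d by auto
  qed
  then obtain x where x: "d \<in> carrier G" "x \<in> ?P (Suc i)" "h d = h (x [^] p)"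
    using Suc.prems by auto
  then have xG: "x \<in> carrier G" using sub by blast
  have "d \<otimes> inv (x [^] p) \<in> ?P (Suc (Suc (Suc i)))"
    using x xG h.hom_eq_iff[of d "x [^] p"] ker[of "d \<otimes> inv (x [^] p)"]
    by (metis inv_closed m_closed nat_pow_closed)
  then show ?case using x by blast
qed

text \<open>If \<open>d\<close> is congruent to \<open>x^p\<close> and \<open>x = z w\<close> with
  \<open>w\<close> a \<open>p^i\<close>-th power and \<open>z\<close> in term \<open>i+1\<close>,
  then modulo term \<open>i+2\<close> the power \<open>x^p\<close> splits as \<open>z^p w^p\<close>
  and \<open>z^p\<close> disappears.\<close>

lemma (in group) powerful_lower_p_series_iterated_pow:
  assumes "odd p" "powerful_p_group p G" "d \<in> lower_p_series p G i"
  shows "\<exists>x\<in>carrier G. d \<otimes> inv (x [^] (p ^ i)) \<in> lower_p_series p G (Suc i)"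
  using assms(3)
proof (induction i arbitrary: d)
  case 0
  then have "d \<otimes> inv (d [^] (p ^ 0)) = \<one>" by simp
  moreover have "\<one> \<in> lower_p_series p G (Suc 0)"
    using lower_p_series_subgroup subgroup.one_closed by blast
  ultimately show ?case using 0 by (intro bexI[of _ d]) simp_all
next
  case (Suc i)
  let ?P = "lower_p_series p G"
  have sub: "?P j \<subseteq> carrier G" for j
    using lower_p_series_subgroup subgroup.subset by blast
  obtain Q :: "'a set monoid" and h where h: "group_hom G Q h"
    and ker: "\<And>x. x \<in> carrier G \<Longrightarrow> h x = \<one>\<^bsub>Q\<^esub> \<longleftrightarrow> x \<in> ?P (Suc (Suc i))"
    using obtain_quotient[OF lower_p_series_normal] by metis
  interpret h: group_hom G Q h by fact
  have ker': "h k = \<one>\<^bsub>Q\<^esub>" if "k \<in> lower_p_step p G (?P (Suc i))" for k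
    using ker[of k] that sub[of "Suc (Suc i)"] by auto
  obtain x where x: "x \<in> ?P i" "d \<otimes> inv (x [^] p) \<in> ?P (Suc (Suc i))"
    using powerful_lower_p_series_pow[OF assms(1,2) Suc.prems] by blast
  obtain y where y: "y \<in> carrier G" "x \<otimes> inv (y [^] (p ^ i)) \<in> ?P (Suc i)"
    using Suc.IH[OF x(1)] by blast
  define w where "w = y [^] (p ^ i)"
  define z where "z = x \<otimes> inv w"
  have G: "x \<in> carrier G" "d \<in> carrier G" "w \<in> carrier G" "z \<in> carrier G"
    using x(1) Suc.prems sub[of i] sub[of "Suc i"] y by (auto simp: w_def z_def)
  have z: "z \<in> ?P (Suc i)" using y by (simp add: z_def w_def)
  have xzw: "x = z \<otimes> w" using G by (simp add: z_def m_assoc)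
  \<comment> \<open>Membership of \<open>w\<close> in term \<open>i\<close> places the commutator of
    \<open>w\<close> and \<open>z\<close> in term \<open>i+1\<close>, which is what splitting
    \<open>(z w)^p\<close> requires.\<close>
  have "inv z \<otimes> x \<in> ?P i"
    using subgroup.m_inv_closed[OF lower_p_series_subgroup] subgroup.m_closed[OF lower_p_series_subgroup]
      x(1) z lower_p_series_decreasing by blast
  then have w: "w \<in> ?P i" unfolding xzw using G by (simp add: inv_mult_cancel)
  have "h ((z \<otimes> w) [^] p) = h (z [^] p) \<otimes>\<^bsub>Q\<^esub> h (w [^] p)"
    using lower_p_step_commutator[OF w G(4)]
    by (intro h.hom_mult_pow_lower_p_step[OF assms(1) G(4,3) _ ker']) auto
  also have "h (z [^] p) = \<one>\<^bsub>Q\<^esub>" by (rule ker'[OF lower_p_step_pow[OF z]])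
  finally have "h (x [^] p) = h (w [^] p)" using G xzw by simp
  also have "w [^] p = y [^] (p ^ Suc i)"
    using y by (simp add: w_def nat_pow_pow mult.commute)
  finally have "h (x [^] p) = h (y [^] (p ^ Suc i))" .
  moreover have "h d = h (x [^] p)"
    using x G h.hom_eq_iff[of d "x [^] p"] ker[of "d \<otimes> inv (x [^] p)"]
    by (metis inv_closed m_closed nat_pow_closed)
  ultimately have "d \<otimes> inv (y [^] (p ^ Suc i)) \<in> ?P (Suc (Suc i))"
    using y G h.hom_eq_iff[of d "y [^] (p ^ Suc i)"] ker[of "d \<otimes> inv (y [^] (p ^ Suc i))"]
    by (metis inv_closed m_closed nat_pow_closed)
  then show ?case using y by blast
qed

text \<open>All \<open>p^k\<close>-th powers are trivial, so the congruence of the preceding lemma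
  puts term \<open>k\<close> inside term \<open>k+1\<close>. The series is then constant from
  \<open>k\<close> on, and it must reach 1.\<close>

lemma (in group) powerful_lower_p_series_trivial:
  assumes "prime p" "odd p" "powerful_p_group p G" "group_exponent G = p ^ k"
  shows "lower_p_series p G k = {\<one>}"
proof -
  let ?P = "lower_p_series p G"
  have anti: "?P j \<subseteq> ?P i" if "i \<le> j" for i j
    using lift_Suc_antimono_le[of ?P, OF lower_p_series_decreasing that] .
  have "?P k \<subseteq> ?P (Suc k)"
  proof
    fix d assume d: "d \<in> ?P k"
    obtain x where x: "x \<in> carrier G" "d \<otimes> inv (x [^] (p ^ k)) \<in> ?P (Suc k)"
      using powerful_lower_p_series_iterated_pow[OF assms(2,3) d] by blast
    have "d \<in> carrier G" using d lower_p_series_subgroup subgroup.subset by blast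
    moreover have "x [^] (p ^ k) = \<one>" using pow_group_exponent[OF x(1)] assms(4) by simp
    ultimately show "d \<in> ?P (Suc k)" using x by simp
  qed
  then have eq: "?P (Suc k) = ?P k" using lower_p_series_decreasing by blast
  have stable: "?P (k + j) = ?P k" for j
  proof (induction j)
    case (Suc j)
    then show ?case using eq by simp
  qed simp
  obtain j where "?P j \<subseteq> {\<one>}"
    using lower_p_series_subset_normal[OF assms(1) _ one_is_normal] assms(3)
    by (auto simp: powerful_p_group_def)
  then have "?P k \<subseteq> {\<one>}" using anti[of j "k + j"] stable[of j] by auto
  moreover have "\<one> \<in> ?P k" using lower_p_series_subgroup subgroup.one_closed by blast
  ultimately show ?thesis by blast
qed

section \<open>Climbing chains of subgroups and subnormal series\<close>

lemma (in group) power_hom_chain: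
  assumes "odd p"
    and central: "\<And>z g. z \<in> Z \<Longrightarrow> g \<in> carrier G \<Longrightarrow> z \<otimes> g = g \<otimes> z"
    and "\<And>j. j \<le> k \<Longrightarrow> subgroup (M j) G"
    and "\<And>j. j < k \<Longrightarrow> M (Suc j) \<subseteq> M j"
    and "\<And>j x. j < k \<Longrightarrow> x \<in> M j \<Longrightarrow> x [^] p \<in> M (Suc j)"
    and "\<And>j x y. j < k \<Longrightarrow> x \<in> M j \<Longrightarrow> y \<in> M j \<Longrightarrow> x \<otimes> y \<otimes> inv x \<otimes> inv y \<in> M (Suc j)"
    and "(\<lambda>x. x [^] q) \<in> hom (G\<lparr>carrier := M k\<rparr>) (G\<lparr>carrier := Z\<rparr>)"
  shows "(\<lambda>x. x [^] (p ^ k * q :: nat)) \<in> hom (G\<lparr>carrier := M 0\<rparr>) (G\<lparr>carrier := Z\<rparr>)"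
  using assms(3-)
proof (induction k arbitrary: M)
  case (Suc k)
  \<comment> \<open>The induction hypothesis is applied to the chain shifted by one, which leaves a
    single step from \<open>M (Suc 0)\<close> to \<open>M 0\<close>. That step takes place inside
    \<open>M 0\<close> regarded as a group of its own.\<close>
  have hom1: "(\<lambda>x. x [^] (p ^ k * q)) \<in> hom (G\<lparr>carrier := M (Suc 0)\<rparr>) (G\<lparr>carrier := Z\<rparr>)"
    by (rule Suc.IH[of "\<lambda>j. M (Suc j)"]) (use Suc.prems in auto)
  have M0: "subgroup (M 0) G" and M1: "subgroup (M (Suc 0)) G" using Suc.prems(1) by simp_all
  interpret M0: group "G\<lparr>carrier := M 0\<rparr>" using M0 by (rule subgroup_imp_group)
  have "(\<lambda>x. x [^]\<^bsub>G\<lparr>carrier := M 0\<rparr>\<^esub> (p * (p ^ k * q)))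
      \<in> hom (G\<lparr>carrier := M 0\<rparr>) (G\<lparr>carrier := M 0, carrier := Z\<rparr>)"
  proof (rule M0.power_hom_step[OF assms(1)])
    show "subgroup (M (Suc 0)) (G\<lparr>carrier := M 0\<rparr>)"
      using Suc.prems(2)[of 0] subgroup_incl[OF M1 M0] by simp
    show "(\<lambda>x. x [^]\<^bsub>G\<lparr>carrier := M 0\<rparr>\<^esub> (p ^ k * q))
        \<in> hom (G\<lparr>carrier := M 0, carrier := M (Suc 0)\<rparr>) (G\<lparr>carrier := M 0, carrier := Z\<rparr>)"
      using hom1 by (simp flip: nat_pow_consistent)
  next
    fix x assume "x \<in> carrier (G\<lparr>carrier := M 0\<rparr>)"
    then show "x [^]\<^bsub>G\<lparr>carrier := M 0\<rparr>\<^esub> p \<in> M (Suc 0)"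
      using Suc.prems(3)[of 0 x] by (simp flip: nat_pow_consistent)
  next
    fix x y assume "x \<in> carrier (G\<lparr>carrier := M 0\<rparr>)" "y \<in> carrier (G\<lparr>carrier := M 0\<rparr>)"
    then show "x \<otimes>\<^bsub>G\<lparr>carrier := M 0\<rparr>\<^esub> y \<otimes>\<^bsub>G\<lparr>carrier := M 0\<rparr>\<^esub> inv\<^bsub>G\<lparr>carrier := M 0\<rparr>\<^esub> x
        \<otimes>\<^bsub>G\<lparr>carrier := M 0\<rparr>\<^esub> inv\<^bsub>G\<lparr>carrier := M 0\<rparr>\<^esub> y \<in> M (Suc 0)"
      using Suc.prems(4)[of 0 x y] M0 by simp
  next
    fix z g assume "z \<in> Z" "g \<in> carrier (G\<lparr>carrier := M 0\<rparr>)"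
    then show "z \<otimes>\<^bsub>G\<lparr>carrier := M 0\<rparr>\<^esub> g = g \<otimes>\<^bsub>G\<lparr>carrier := M 0\<rparr>\<^esub> z"
      using central subgroup.subset[OF M0] by auto
  qed
  then show ?case by (simp add: mult.assoc flip: nat_pow_consistent)
qed simp

text \<open>The lower \<open>p\<close>-series of \<open>Q\<close> is pulled back along
  \<open>\<theta>\<close>. Its preimages lead from \<open>A\<close> down to the kernel of
  \<open>\<theta>\<close> in exactly \<open>k\<close> steps, where \<open>p^k\<close> is the
  exponent of \<open>Q\<close>.\<close>

lemma (in group) power_hom_extension:
  assumes "prime p" "odd p" "powerful_p_group p Q"
    and central: "\<And>z g. z \<in> Z \<Longrightarrow> g \<in> carrier G \<Longrightarrow> z \<otimes> g = g \<otimes> z"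
    and A: "subgroup A G" and \<theta>: "group_hom (G\<lparr>carrier := A\<rparr>) Q \<theta>"
    and B: "(\<lambda>x. x [^] q) \<in> hom (G\<lparr>carrier := {x \<in> A. \<theta> x = \<one>\<^bsub>Q\<^esub>}\<rparr>) (G\<lparr>carrier := Z\<rparr>)"
  shows "(\<lambda>x. x [^] (group_exponent Q * q :: nat)) \<in> hom (G\<lparr>carrier := A\<rparr>) (G\<lparr>carrier := Z\<rparr>)"
proof -
  interpret A: subgroup A G by fact
  interpret \<theta>: group_hom "G\<lparr>carrier := A\<rparr>" Q \<theta> by fact
  obtain k where k: "group_exponent Q = p ^ k"
    using finite_p_group_exponent assms(1,3) unfolding powerful_p_group_def by blast
  let ?P = "lower_p_series p Q"
  have \<theta>_mult: "\<theta> (x \<otimes> y) = \<theta> x \<otimes>\<^bsub>Q\<^esub> \<theta> y" if "x \<in> A" "y \<in> A" for x y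
    using \<theta>.hom_mult that by simp
  have \<theta>_inv: "\<theta> (inv x) = inv\<^bsub>Q\<^esub> \<theta> x" if "x \<in> A" for x
    using \<theta>.hom_inv[of x] that A by simp
  have \<theta>_pow: "\<theta> (x [^] n) = \<theta> x [^]\<^bsub>Q\<^esub> n" if "x \<in> A" for x and n :: nat
    using \<theta>.hom_nat_pow[of x n] that by (simp flip: nat_pow_consistent)
  have \<theta>_closed: "\<theta> x \<in> carrier Q" if "x \<in> A" for x
    using \<theta>.hom_closed that by simp
  have A_pow: "x [^] n \<in> A" if "x \<in> A" for x and n :: nat
    using subgroup_int_pow_closed[OF A that, of "int n"] by (simp add: int_pow_int)
  define M where "M = (\<lambda>j. {x \<in> A. \<theta> x \<in> ?P j})"
  have "(\<lambda>x. x [^] (p ^ k * q :: nat)) \<in> hom (G\<lparr>carrier := M 0\<rparr>) (G\<lparr>carrier := Z\<rparr>)"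
  proof (rule power_hom_chain[OF assms(2) central])
    show "subgroup (M j) G" for j
    proof -
      interpret P: subgroup "?P j" Q by (rule \<theta>.H.lower_p_series_subgroup)
      have "\<theta> \<one> = \<one>\<^bsub>Q\<^esub>" using \<theta>.hom_one by simp
      then have "M j \<noteq> {}" by (auto simp: M_def intro!: exI[of _ \<one>])
      then show ?thesis
        by (intro subgroupI) (auto simp: M_def \<theta>_mult \<theta>_inv)
    qed
    show "M (Suc j) \<subseteq> M j" for j
      unfolding M_def using \<theta>.H.lower_p_series_decreasing[of p j] by blast
    show "x [^] p \<in> M (Suc j)" if "x \<in> M j" for j x
      using that \<theta>.H.lower_p_step_pow[of "\<theta> x" "?P j" p] by (simp add: M_def \<theta>_pow A_pow)
    show "x \<otimes> y \<otimes> inv x \<otimes> inv y \<in> M (Suc j)" if "x \<in> M j" "y \<in> M j" for j x y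
      using that \<theta>.H.lower_p_step_commutator[of "\<theta> x" "?P j" "\<theta> y" p]
      by (simp add: M_def \<theta>_mult \<theta>_inv \<theta>_closed)
    have "M k = {x \<in> A. \<theta> x = \<one>\<^bsub>Q\<^esub>}"
      unfolding M_def \<theta>.H.powerful_lower_p_series_trivial[OF assms(1-3) k] by simp
    then show "(\<lambda>x. x [^] q) \<in> hom (G\<lparr>carrier := M k\<rparr>) (G\<lparr>carrier := Z\<rparr>)"
      using B by simp
  qed
  moreover have "M 0 = A" using \<theta>_closed by (auto simp: M_def)
  ultimately show ?thesis using k by simp
qed

text \<open>Passing from the preimage of \<open>S (j-1)\<close> to that of \<open>S j\<close> costs
  the exponent of factor \<open>j\<close>. The product therefore starts at \<open>Suc i\<close>, and
  \<open>i = 1\<close> leaves out exactly the top factor.\<close>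

lemma (in group_hom) power_hom_subnormal_series:
  assumes "prime p" "odd p"
    and central: "\<And>z g. z \<in> kernel G H h \<Longrightarrow> g \<in> carrier G \<Longrightarrow> z \<otimes>\<^bsub>G\<^esub> g = g \<otimes>\<^bsub>G\<^esub> z"
    and series: "subnormal_series H S r"
    and powerful: "\<And>i. i \<in> {1..r} \<Longrightarrow> powerful_p_group p (series_factor H S i)"
    and "i \<le> r"
  shows "subgroup {u \<in> carrier G. h u \<in> S i} G \<and>
    (\<lambda>u. u [^]\<^bsub>G\<^esub> (\<Prod>j=Suc i..r. group_exponent (series_factor H S j)))
      \<in> hom (G\<lparr>carrier := {u \<in> carrier G. h u \<in> S i}\<rparr>) (G\<lparr>carrier := kernel G H h\<rparr>)"
proof -
  have subS: "i \<le> r \<Longrightarrow> subgroup (S i) H" for i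
  proof (induction i)
    case 0
    then show ?case using series H.subgroup_self by (simp add: subnormal_series_def)
  next
    case (Suc i)
    then have "S (Suc i) \<lhd> H\<lparr>carrier := S i\<rparr>"
      using series by (auto simp: subnormal_series_def dest: bspec[of _ _ "Suc i"])
    then show ?case
      using Suc H.incl_subgroup normal_imp_subgroup by fastforce
  qed
  have subA: "subgroup {u \<in> carrier G. h u \<in> S i} G" if "i \<le> r" for i
  proof -
    interpret subgroup "S i" H using subS that .
    show ?thesis by (rule G.subgroupI) (auto intro!: exI[of _ "\<one>\<^bsub>G\<^esub>"])
  qed
  have "(\<lambda>u. u [^]\<^bsub>G\<^esub> (\<Prod>j=Suc i..r. group_exponent (series_factor H S j)))
      \<in> hom (G\<lparr>carrier := {u \<in> carrier G. h u \<in> S i}\<rparr>) (G\<lparr>carrier := kernel G H h\<rparr>)"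
    using \<open>i \<le> r\<close>
  proof (induction rule: inc_induct)
    \<comment> \<open>The induction descends from \<open>r\<close>. There the preimage is the
      central kernel itself, the product is empty, and the power map is the identity.\<close>
    case base
    have "{u \<in> carrier G. h u \<in> S r} = kernel G H h"
      using series by (simp add: subnormal_series_def kernel_def)
    then show ?case by (auto simp: hom_def kernel_def)
  next
    case (step n)
    let ?A = "{u \<in> carrier G. h u \<in> S n}"
    let ?Q = "series_factor H S (Suc n)"
    define \<theta> where "\<theta> = (\<lambda>u. S (Suc n) #>\<^bsub>H\<^esub> h u)"
    have norm: "S (Suc n) \<lhd> H\<lparr>carrier := S n\<rparr>"
      using series step.hyps by (auto simp: subnormal_series_def dest: bspec[of _ _ "Suc n"])
    interpret N: normal "S (Suc n)" "H\<lparr>carrier := S n\<rparr>" by fact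
    have Q: "?Q = H\<lparr>carrier := S n\<rparr> Mod S (Suc n)" by (simp add: series_factor_def)
    have A: "subgroup ?A G" using subA step.hyps by simp
    have "\<theta> \<in> hom (G\<lparr>carrier := ?A\<rparr>) ?Q"
    proof (rule homI)
      fix x assume "x \<in> carrier (G\<lparr>carrier := ?A\<rparr>)"
      then show "\<theta> x \<in> carrier ?Q"
        using hom_in_carrier[OF N.r_coset_hom_Mod, of "h x"] by (simp add: Q \<theta>_def)
    next
      fix x y assume "x \<in> carrier (G\<lparr>carrier := ?A\<rparr>)" "y \<in> carrier (G\<lparr>carrier := ?A\<rparr>)"
      then show "\<theta> (x \<otimes>\<^bsub>G\<lparr>carrier := ?A\<rparr>\<^esub> y) = \<theta> x \<otimes>\<^bsub>?Q\<^esub> \<theta> y"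
        using Group.hom_mult[OF N.r_coset_hom_Mod, of "h x" "h y"] by (simp add: Q \<theta>_def)
    qed
    then have \<theta>: "group_hom (G\<lparr>carrier := ?A\<rparr>) ?Q \<theta>"
      using G.subgroup_imp_group[OF A] N.factorgroup_is_group Q
      by (simp add: group_hom_def group_hom_axioms_def)
    have ker: "{u \<in> ?A. \<theta> u = \<one>\<^bsub>?Q\<^esub>} = {u \<in> carrier G. h u \<in> S (Suc n)}"
    proof -
      have "S (Suc n) #>\<^bsub>H\<^esub> x = S (Suc n) \<longleftrightarrow> x \<in> S (Suc n)" if "x \<in> S n" for x
        using N.coset_join1[of "S (Suc n)" x] N.coset_join2[of x "S (Suc n)"] that N.subset N.is_subgroup
        by auto
      then show ?thesis using N.subset by (auto simp: \<theta>_def Q)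
    qed
    have "(\<lambda>u. u [^]\<^bsub>G\<^esub> (group_exponent ?Q * (\<Prod>j=Suc (Suc n)..r. group_exponent (series_factor H S j))))
      \<in> hom (G\<lparr>carrier := ?A\<rparr>) (G\<lparr>carrier := kernel G H h\<rparr>)"
      by (rule G.power_hom_extension[OF assms(1,2) powerful central A \<theta>])
        (use step.hyps step.IH ker in auto)
    moreover have "(\<Prod>j=Suc n..r. group_exponent (series_factor H S j)) =
        group_exponent ?Q * (\<Prod>j=Suc (Suc n)..r. group_exponent (series_factor H S j))"
      using step.hyps by (intro prod.atLeast_Suc_atMost) simp
    ultimately show ?case by simp
  qed
  then show ?thesis using subA \<open>i \<le> r\<close> by blast
qed

section \<open>Cocycles and central extensions\<close>

locale cocycle2 = G?: group G + A?: comm_group A for G (structure) and A (structure) +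
  fixes f
  assumes cocycle: "f \<in> cocycles2 G A"
begin

lemma closed [simp]: "x \<in> carrier G \<Longrightarrow> y \<in> carrier G \<Longrightarrow> f (x, y) \<in> carrier A"
  using cocycle by (auto simp: cocycles2_def)

lemma cocycle_eq:
  "x \<in> carrier G \<Longrightarrow> y \<in> carrier G \<Longrightarrow> z \<in> carrier G \<Longrightarrow>
    f (y, z) \<otimes>\<^bsub>A\<^esub> f (x, y \<otimes>\<^bsub>G\<^esub> z) = f (x \<otimes>\<^bsub>G\<^esub> y, z) \<otimes>\<^bsub>A\<^esub> f (x, y)"
  using cocycle by (simp add: cocycles2_def)

text \<open>Cocycles are not assumed to be normalised, so this value need not be the identity; it
  reappears as a correction in the unit of the extension and in the embedding of
  \<open>A\<close>.\<close>

definition f0 where "f0 = f (\<one>\<^bsub>G\<^esub>, \<one>\<^bsub>G\<^esub>)"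

lemma f0_closed [simp]: "f0 \<in> carrier A"
  by (simp add: f0_def)

lemma one_left [simp]:
  assumes "x \<in> carrier G" shows "f (\<one>\<^bsub>G\<^esub>, x) = f0"
  using cocycle_eq[of "\<one>\<^bsub>G\<^esub>" "\<one>\<^bsub>G\<^esub>" x] assms by (simp add: f0_def)

lemma one_right [simp]:
  assumes "x \<in> carrier G" shows "f (x, \<one>\<^bsub>G\<^esub>) = f0"
  using cocycle_eq[of x "\<one>\<^bsub>G\<^esub>" "\<one>\<^bsub>G\<^esub>"] assms by simp

definition extension where
  "extension = \<lparr>carrier = carrier A \<times> carrier G,
    monoid.mult = (\<lambda>(a, x) (b, y). (a \<otimes>\<^bsub>A\<^esub> b \<otimes>\<^bsub>A\<^esub> f (x, y), x \<otimes>\<^bsub>G\<^esub> y)),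
    one = (inv\<^bsub>A\<^esub> f0, \<one>\<^bsub>G\<^esub>)\<rparr>"

lemma extension_simps [simp]:
  "carrier extension = carrier A \<times> carrier G"
  "(a, x) \<otimes>\<^bsub>extension\<^esub> (b, y) = (a \<otimes>\<^bsub>A\<^esub> b \<otimes>\<^bsub>A\<^esub> f (x, y), x \<otimes>\<^bsub>G\<^esub> y)"
  "\<one>\<^bsub>extension\<^esub> = (inv\<^bsub>A\<^esub> f0, \<one>\<^bsub>G\<^esub>)"
  by (simp_all add: extension_def)

text \<open>Associativity is precisely the cocycle identity.\<close>

lemma group_extension: "group extension"
proof (rule groupI)
  fix u v w
  assume "u \<in> carrier extension" "v \<in> carrier extension" "w \<in> carrier extension"
  then obtain a x b y c z where uvw: "u = (a, x)" "v = (b, y)" "w = (c, z)"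
    "a \<in> carrier A" "b \<in> carrier A" "c \<in> carrier A"
    "x \<in> carrier G" "y \<in> carrier G" "z \<in> carrier G" by auto
  have "a \<otimes>\<^bsub>A\<^esub> b \<otimes>\<^bsub>A\<^esub> f (x, y) \<otimes>\<^bsub>A\<^esub> c \<otimes>\<^bsub>A\<^esub> f (x \<otimes>\<^bsub>G\<^esub> y, z) =
      a \<otimes>\<^bsub>A\<^esub> b \<otimes>\<^bsub>A\<^esub> c \<otimes>\<^bsub>A\<^esub> (f (x \<otimes>\<^bsub>G\<^esub> y, z) \<otimes>\<^bsub>A\<^esub> f (x, y))"
    using uvw by (simp add: A.m_ac)
  also have "f (x \<otimes>\<^bsub>G\<^esub> y, z) \<otimes>\<^bsub>A\<^esub> f (x, y) = f (y, z) \<otimes>\<^bsub>A\<^esub> f (x, y \<otimes>\<^bsub>G\<^esub> z)"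
    using uvw by (simp add: cocycle_eq)
  also have "a \<otimes>\<^bsub>A\<^esub> b \<otimes>\<^bsub>A\<^esub> c \<otimes>\<^bsub>A\<^esub> (f (y, z) \<otimes>\<^bsub>A\<^esub> f (x, y \<otimes>\<^bsub>G\<^esub> z)) =
      a \<otimes>\<^bsub>A\<^esub> (b \<otimes>\<^bsub>A\<^esub> c \<otimes>\<^bsub>A\<^esub> f (y, z)) \<otimes>\<^bsub>A\<^esub> f (x, y \<otimes>\<^bsub>G\<^esub> z)"
    using uvw by (simp add: A.m_ac)
  finally show "u \<otimes>\<^bsub>extension\<^esub> v \<otimes>\<^bsub>extension\<^esub> w = u \<otimes>\<^bsub>extension\<^esub> (v \<otimes>\<^bsub>extension\<^esub> w)"
    using uvw by (simp add: G.m_assoc)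
next
  fix u assume "u \<in> carrier extension"
  then obtain a x where u: "u = (a, x)" "a \<in> carrier A" "x \<in> carrier G" by auto
  let ?i = "f (inv\<^bsub>G\<^esub> x, x)"
  have "inv\<^bsub>A\<^esub> f0 \<otimes>\<^bsub>A\<^esub> a \<otimes>\<^bsub>A\<^esub> f0 = a \<otimes>\<^bsub>A\<^esub> (inv\<^bsub>A\<^esub> f0 \<otimes>\<^bsub>A\<^esub> f0)"
    using u by (simp only: A.m_ac A.inv_closed f0_closed)
  then show "\<one>\<^bsub>extension\<^esub> \<otimes>\<^bsub>extension\<^esub> u = u" using u by simp
  \<comment> \<open>The first coordinate solves the equation that the product with \<open>u\<close>
    has first coordinate \<open>inv f0\<close>, the one of the unit.\<close>
  let ?v = "(inv\<^bsub>A\<^esub> f0 \<otimes>\<^bsub>A\<^esub> inv\<^bsub>A\<^esub> a \<otimes>\<^bsub>A\<^esub> inv\<^bsub>A\<^esub> ?i, inv\<^bsub>G\<^esub> x)"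
  have "inv\<^bsub>A\<^esub> f0 \<otimes>\<^bsub>A\<^esub> inv\<^bsub>A\<^esub> a \<otimes>\<^bsub>A\<^esub> inv\<^bsub>A\<^esub> ?i \<otimes>\<^bsub>A\<^esub> a \<otimes>\<^bsub>A\<^esub> ?i =
      inv\<^bsub>A\<^esub> f0 \<otimes>\<^bsub>A\<^esub> (inv\<^bsub>A\<^esub> a \<otimes>\<^bsub>A\<^esub> a) \<otimes>\<^bsub>A\<^esub> (inv\<^bsub>A\<^esub> ?i \<otimes>\<^bsub>A\<^esub> ?i)"
    using u by (simp only: A.m_ac A.m_closed A.inv_closed closed G.inv_closed f0_closed)
  then show "\<exists>v\<in>carrier extension. v \<otimes>\<^bsub>extension\<^esub> u = \<one>\<^bsub>extension\<^esub>"
    using u by (intro bexI[of _ ?v]) simp_all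
qed auto

lemma snd_hom: "group_hom extension G snd"
  using group_extension by (auto simp: group_hom_def group_hom_axioms_def hom_def)

lemma kernel_snd: "kernel extension G snd = carrier A \<times> {\<one>\<^bsub>G\<^esub>}"
  by (auto simp: kernel_def)

text \<open>\<open>f\<close> has the same value \<open>f0\<close> at \<open>(1, x)\<close> and at
  \<open>(x, 1)\<close>, so both products agree because \<open>A\<close> is commutative.\<close>

lemma kernel_central:
  assumes "z \<in> kernel extension G snd" "g \<in> carrier extension"
  shows "z \<otimes>\<^bsub>extension\<^esub> g = g \<otimes>\<^bsub>extension\<^esub> z"
  using assms by (auto simp: kernel_snd A.m_comm)

text \<open>Applying the homomorphism \<open>\<chi>\<close> induced by the \<open>n\<close>-th power map to the factorization of the
  section \<open>s\<close> of the extension through a section \<open>T\<close> of \<open>G Mod N\<close> splits off an inflated cocycle.\<close>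

lemma pow_cohomologous_inflation:
  assumes N: "N \<lhd> G"
    and hom: "(\<lambda>u. u [^]\<^bsub>extension\<^esub> (n::nat))
      \<in> hom (extension\<lparr>carrier := carrier A \<times> N\<rparr>) (extension\<lparr>carrier := carrier A \<times> {\<one>\<^bsub>G\<^esub>}\<rparr>)"
  obtains \<beta> k where "\<beta> \<in> cocycles2 (G Mod N) A" "k \<in> carrier G \<rightarrow> carrier A"
    "\<And>x y. x \<in> carrier G \<Longrightarrow> y \<in> carrier G \<Longrightarrow>
      f (x, y) [^]\<^bsub>A\<^esub> n \<otimes>\<^bsub>A\<^esub> k (x \<otimes>\<^bsub>G\<^esub> y) = \<beta> (N #>\<^bsub>G\<^esub> x, N #>\<^bsub>G\<^esub> y) \<otimes>\<^bsub>A\<^esub> (k x \<otimes>\<^bsub>A\<^esub> k y)"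
proof -
  interpret N: normal N G by fact
  interpret E: group extension by (rule group_extension)
  interpret snd: group_hom extension G snd by (rule snd_hom)
  let ?M = "carrier A \<times> N"
  \<comment> \<open>\<open>\<iota>\<close> is the embedding of \<open>A\<close> as the kernel; the
    shift by \<open>inv f0\<close> makes it multiplicative. On that kernel its inverse multiplies
    the first coordinate by \<open>f0\<close>, so \<open>\<chi>\<close> is the \<open>n\<close>-th
    power map read as a map into \<open>A\<close>.\<close>
  define \<iota> where "\<iota> = (\<lambda>a. (a \<otimes>\<^bsub>A\<^esub> inv\<^bsub>A\<^esub> f0, \<one>\<^bsub>G\<^esub>))"
  define \<chi> where "\<chi> = (\<lambda>u. fst (u [^]\<^bsub>extension\<^esub> n) \<otimes>\<^bsub>A\<^esub> f0)"
  have M_pow: "u [^]\<^bsub>extension\<^esub> n \<in> carrier A \<times> {\<one>\<^bsub>G\<^esub>}" if "u \<in> ?M" for u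
    using hom that by (auto simp: hom_def)
  have M_sub: "u \<in> carrier extension" if "u \<in> ?M" for u using that by auto
  have \<chi>_closed: "\<chi> u \<in> carrier A" if "u \<in> ?M" for u
    using M_pow[OF that] by (auto simp: \<chi>_def)
  have \<chi>_mult: "\<chi> (u \<otimes>\<^bsub>extension\<^esub> v) = \<chi> u \<otimes>\<^bsub>A\<^esub> \<chi> v" if u: "u \<in> ?M" and v: "v \<in> ?M" for u v
  proof -
    obtain a b where ab: "u [^]\<^bsub>extension\<^esub> n = (a, \<one>\<^bsub>G\<^esub>)" "v [^]\<^bsub>extension\<^esub> n = (b, \<one>\<^bsub>G\<^esub>)"
      "a \<in> carrier A" "b \<in> carrier A"
      using M_pow[OF u] M_pow[OF v] by (elim SigmaE) auto
    moreover have "(u \<otimes>\<^bsub>extension\<^esub> v) [^]\<^bsub>extension\<^esub> n = u [^]\<^bsub>extension\<^esub> n \<otimes>\<^bsub>extension\<^esub> v [^]\<^bsub>extension\<^esub> n"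
      using Group.hom_mult[OF hom, of u v] u v by simp
    ultimately show ?thesis by (simp add: \<chi>_def A.m_ac)
  qed
  \<comment> \<open>The \<open>n\<close>-th power of \<open>u\<close> is central, so conjugating
    \<open>u\<close> does not change it.\<close>
  have \<chi>_conj: "\<chi> (g \<otimes>\<^bsub>extension\<^esub> u \<otimes>\<^bsub>extension\<^esub> inv\<^bsub>extension\<^esub> g) = \<chi> u"
    if "u \<in> ?M" "g \<in> carrier extension" for u g
  proof -
    have "u [^]\<^bsub>extension\<^esub> n \<in> kernel extension G snd" using M_pow[OF that(1)] by (simp add: kernel_snd)
    then have "g \<otimes>\<^bsub>extension\<^esub> u [^]\<^bsub>extension\<^esub> n \<otimes>\<^bsub>extension\<^esub> inv\<^bsub>extension\<^esub> g = u [^]\<^bsub>extension\<^esub> n"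
      using kernel_central[of "u [^]\<^bsub>extension\<^esub> n" g] that(2) M_sub[OF that(1)]
      by (metis E.inv_solve_right' E.m_closed E.nat_pow_closed)
    then show ?thesis using E.conjugate_pow[of u g n] that(2) M_sub[OF that(1)] by (simp only: \<chi>_def)
  qed
  have \<iota>_M: "\<iota> a \<in> ?M" if "a \<in> carrier A" for a using that by (simp add: \<iota>_def)
  have \<iota>_pow: "\<iota> a [^]\<^bsub>extension\<^esub> m = \<iota> (a [^]\<^bsub>A\<^esub> m)" if "a \<in> carrier A" for a and m :: nat
  proof (induction m)
    case (Suc m)
    have "a [^]\<^bsub>A\<^esub> m \<otimes>\<^bsub>A\<^esub> inv\<^bsub>A\<^esub> f0 \<otimes>\<^bsub>A\<^esub> (a \<otimes>\<^bsub>A\<^esub> inv\<^bsub>A\<^esub> f0) \<otimes>\<^bsub>A\<^esub> f0 =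
        a [^]\<^bsub>A\<^esub> m \<otimes>\<^bsub>A\<^esub> a \<otimes>\<^bsub>A\<^esub> inv\<^bsub>A\<^esub> f0 \<otimes>\<^bsub>A\<^esub> (inv\<^bsub>A\<^esub> f0 \<otimes>\<^bsub>A\<^esub> f0)"
      using that by (simp only: A.m_ac A.m_closed A.inv_closed A.nat_pow_closed f0_closed)
    then show ?case using Suc that by (simp add: \<iota>_def)
  qed (use that in \<open>simp add: \<iota>_def\<close>)
  have \<chi>_\<iota>: "\<chi> (\<iota> a) = a [^]\<^bsub>A\<^esub> n" if "a \<in> carrier A" for a
    unfolding \<chi>_def \<iota>_pow[OF that] using that by (simp add: \<iota>_def A.m_assoc)
  define s where "s = (\<lambda>x. (\<one>\<^bsub>A\<^esub>, x) :: 'c \<times> 'a)"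
  have s_closed: "s x \<in> carrier extension" if "x \<in> carrier G" for x using that by (simp add: s_def)
  have s_mult: "s x \<otimes>\<^bsub>extension\<^esub> s y = \<iota> (f (x, y)) \<otimes>\<^bsub>extension\<^esub> s (x \<otimes>\<^bsub>G\<^esub> y)"
    if "x \<in> carrier G" "y \<in> carrier G" for x y
    using that by (simp add: s_def \<iota>_def A.m_assoc)
  define T where "T = (\<lambda>Q. s (SOME x. x \<in> Q))"
  have rep: "(SOME x. x \<in> Q) \<in> Q" if Q: "Q \<in> carrier (G Mod N)" for Q
  proof -
    obtain x where "x \<in> carrier G" "Q = N #>\<^bsub>G\<^esub> x" using Q by (auto simp: carrier_FactGroup)
    then have "x \<in> Q" using G.rcos_self N.is_subgroup by simp
    then show ?thesis by (rule someI)
  qed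
  have T: "T Q \<in> carrier extension \<and> snd (T Q) \<in> Q \<and> N #>\<^bsub>G\<^esub> snd (T Q) = Q"
    if Q: "Q \<in> carrier (G Mod N)" for Q
  proof -
    obtain x where x: "x \<in> carrier G" "Q = N #>\<^bsub>G\<^esub> x" using Q by (auto simp: carrier_FactGroup)
    have "snd (T Q) \<in> Q" using rep[OF Q] by (simp add: T_def s_def)
    moreover from this have "snd (T Q) \<in> carrier G" using x G.r_coset_subset_G N.subset by blast
    moreover from calculation have "N #>\<^bsub>G\<^esub> snd (T Q) = Q"
      using x G.repr_independence N.is_subgroup by metis
    ultimately show ?thesis by (simp add: T_def s_def)
  qed
  have Q_mult: "Q \<otimes>\<^bsub>G Mod N\<^esub> R \<in> carrier (G Mod N)"
    if "Q \<in> carrier (G Mod N)" "R \<in> carrier (G Mod N)" for Q R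
    using that N.factorgroup_is_group group.is_monoid monoid.m_closed by metis
  have coset_mult: "N #>\<^bsub>G\<^esub> (x \<otimes>\<^bsub>G\<^esub> y) = (N #>\<^bsub>G\<^esub> x) \<otimes>\<^bsub>G Mod N\<^esub> (N #>\<^bsub>G\<^esub> y)"
    if "x \<in> carrier G" "y \<in> carrier G" for x y
    using that N.rcos_sum by simp
  have coset_closed: "N #>\<^bsub>G\<^esub> x \<in> carrier (G Mod N)" if "x \<in> carrier G" for x
    using that by (simp add: carrier_FactGroup)
  have M_I: "u \<otimes>\<^bsub>extension\<^esub> inv\<^bsub>extension\<^esub> v \<in> ?M"
    if "u \<in> carrier extension" "v \<in> carrier extension" "N #>\<^bsub>G\<^esub> snd u = N #>\<^bsub>G\<^esub> snd v" for u v
  proof -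
    have "snd (u \<otimes>\<^bsub>extension\<^esub> inv\<^bsub>extension\<^esub> v) = snd u \<otimes>\<^bsub>G\<^esub> inv\<^bsub>G\<^esub> snd v"
      using that(1,2) by (simp only: snd.hom_mult E.inv_closed snd.hom_inv)
    also have "\<dots> \<in> N"
      using N.rcos_module[of "snd v" "snd u"] that G.rcos_self[of "snd u" N] N.is_subgroup
      by auto
    finally show ?thesis
      using E.m_closed[OF that(1) E.inv_closed[OF that(2)]] by (auto simp: mem_Times_iff)
  qed
  \<comment> \<open>\<open>u x\<close> measures how far the section \<open>s\<close> is from
    factoring through the cosets of \<open>N\<close>, and \<open>w\<close> below is the factor set
    of the lifted coset representatives \<open>T\<close>. Since \<open>w\<close> depends on cosets
    alone, its image under \<open>\<chi>\<close> is the candidate for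
    \<open>\<beta>\<close>.\<close>
  define u where "u = (\<lambda>x. s x \<otimes>\<^bsub>extension\<^esub> inv\<^bsub>extension\<^esub> T (N #>\<^bsub>G\<^esub> x))"
  have u_M: "u x \<in> ?M" if "x \<in> carrier G" for x
    unfolding u_def using that T[OF coset_closed[OF that]] by (intro M_I) (auto simp: s_def)
  define w where "w = (\<lambda>Q R. T Q \<otimes>\<^bsub>extension\<^esub> T R \<otimes>\<^bsub>extension\<^esub> inv\<^bsub>extension\<^esub> T (Q \<otimes>\<^bsub>G Mod N\<^esub> R))"
  have w_M: "w Q R \<in> ?M" if "Q \<in> carrier (G Mod N)" "R \<in> carrier (G Mod N)" for Q R
    unfolding w_def
  proof (rule M_I)
    have TQ: "T Q \<in> carrier extension" "T R \<in> carrier extension" using T that by blast+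
    then show "T Q \<otimes>\<^bsub>extension\<^esub> T R \<in> carrier extension" by (rule E.m_closed)
    show "T (Q \<otimes>\<^bsub>G Mod N\<^esub> R) \<in> carrier extension" using T Q_mult[OF that] by blast
    have "N #>\<^bsub>G\<^esub> snd (T Q \<otimes>\<^bsub>extension\<^esub> T R) = Q \<otimes>\<^bsub>G Mod N\<^esub> R"
      using TQ T[OF that(1)] T[OF that(2)] coset_mult[of "snd (T Q)" "snd (T R)"]
      by (simp only: snd.hom_mult snd.hom_closed)
    then show "N #>\<^bsub>G\<^esub> snd (T Q \<otimes>\<^bsub>extension\<^esub> T R) = N #>\<^bsub>G\<^esub> snd (T (Q \<otimes>\<^bsub>G Mod N\<^esub> R))"
      using T[OF Q_mult[OF that]] by simp
  qed
  define k where "k = (\<lambda>x. \<chi> (u x))"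
  have k: "k x \<in> carrier A" if "x \<in> carrier G" for x using \<chi>_closed u_M that by (simp add: k_def)
  define \<beta> where "\<beta> = (\<lambda>(Q, R) \<in> carrier (G Mod N) \<times> carrier (G Mod N). \<chi> (w Q R))"
  have \<beta>_closed: "\<beta> (Q, R) \<in> carrier A" if "Q \<in> carrier (G Mod N)" "R \<in> carrier (G Mod N)" for Q R
    using that \<chi>_closed w_M by (simp add: \<beta>_def)
  have eq: "f (x, y) [^]\<^bsub>A\<^esub> n \<otimes>\<^bsub>A\<^esub> k (x \<otimes>\<^bsub>G\<^esub> y) = \<beta> (N #>\<^bsub>G\<^esub> x, N #>\<^bsub>G\<^esub> y) \<otimes>\<^bsub>A\<^esub> (k x \<otimes>\<^bsub>A\<^esub> k y)"
    if "x \<in> carrier G" "y \<in> carrier G" for x y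
  proof -
    let ?Q = "N #>\<^bsub>G\<^esub> x" and ?R = "N #>\<^bsub>G\<^esub> y"
    have Q: "?Q \<in> carrier (G Mod N)" "?R \<in> carrier (G Mod N)" using coset_closed that by auto
    have E: "s x \<in> carrier extension" "s y \<in> carrier extension" "s (x \<otimes>\<^bsub>G\<^esub> y) \<in> carrier extension"
      "T ?Q \<in> carrier extension" "T ?R \<in> carrier extension"
      "T (?Q \<otimes>\<^bsub>G Mod N\<^esub> ?R) \<in> carrier extension" "\<iota> (f (x, y)) \<in> carrier extension"
      using that s_closed T Q Q_mult \<iota>_M M_sub by auto
    \<comment> \<open>In \<open>s x s y = u x T(Q) u y T(R)\<close> the factor \<open>T(Q)\<close>
      has to be moved past \<open>u y\<close>, which turns \<open>u y\<close> into \<open>v\<close>.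
      By conjugation invariance \<open>\<chi>\<close> does not see the difference.\<close>
    define v where "v = T ?Q \<otimes>\<^bsub>extension\<^esub> u y \<otimes>\<^bsub>extension\<^esub> inv\<^bsub>extension\<^esub> T ?Q"
    have v: "v \<in> ?M"
    proof -
      have "v = (T ?Q \<otimes>\<^bsub>extension\<^esub> u y) \<otimes>\<^bsub>extension\<^esub> inv\<^bsub>extension\<^esub> T ?Q" by (simp add: v_def)
      also have "\<dots> \<in> ?M"
      proof (rule M_I)
        have uy: "u y \<in> carrier extension" "snd (u y) \<in> N" using u_M M_sub that by force+
        show "T ?Q \<otimes>\<^bsub>extension\<^esub> u y \<in> carrier extension" by (rule E.m_closed[OF E(4) uy(1)])
        have uy1: "N #>\<^bsub>G\<^esub> snd (u y) = \<one>\<^bsub>G Mod N\<^esub>"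
          using uy G.coset_join2 N.is_subgroup N.mem_carrier by (metis one_FactGroup)
        have "N #>\<^bsub>G\<^esub> snd (T ?Q \<otimes>\<^bsub>extension\<^esub> u y) = ?Q \<otimes>\<^bsub>G Mod N\<^esub> \<one>\<^bsub>G Mod N\<^esub>"
          using E(4) uy T[OF Q(1)] uy1 coset_mult[of "snd (T ?Q)" "snd (u y)"]
          by (simp only: snd.hom_mult snd.hom_closed)
        then show "N #>\<^bsub>G\<^esub> snd (T ?Q \<otimes>\<^bsub>extension\<^esub> u y) = N #>\<^bsub>G\<^esub> snd (T ?Q)"
          using T[OF Q(1)] Q(1) N.factorgroup_is_group group.is_monoid monoid.r_one by metis
      qed (rule E(4))
      finally show ?thesis .
    qed
    have "\<iota> (f (x, y)) \<otimes>\<^bsub>extension\<^esub> u (x \<otimes>\<^bsub>G\<^esub> y) =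
        s x \<otimes>\<^bsub>extension\<^esub> s y \<otimes>\<^bsub>extension\<^esub> inv\<^bsub>extension\<^esub> T (?Q \<otimes>\<^bsub>G Mod N\<^esub> ?R)"
      unfolding s_mult[OF that] u_def coset_mult[OF that] using E
      by (intro E.m_assoc[symmetric] E.inv_closed)
    also have "\<dots> = u x \<otimes>\<^bsub>extension\<^esub> v \<otimes>\<^bsub>extension\<^esub> w ?Q ?R"
      unfolding u_def v_def w_def using E
      by (simp add: E.word_simps del: extension_simps mult_FactGroup)
    finally have "\<chi> (\<iota> (f (x, y)) \<otimes>\<^bsub>extension\<^esub> u (x \<otimes>\<^bsub>G\<^esub> y)) = \<chi> (u x \<otimes>\<^bsub>extension\<^esub> v \<otimes>\<^bsub>extension\<^esub> w ?Q ?R)"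
      by (rule arg_cong)
    moreover have "\<chi> (\<iota> (f (x, y)) \<otimes>\<^bsub>extension\<^esub> u (x \<otimes>\<^bsub>G\<^esub> y)) = f (x, y) [^]\<^bsub>A\<^esub> n \<otimes>\<^bsub>A\<^esub> k (x \<otimes>\<^bsub>G\<^esub> y)"
      using \<chi>_mult[OF \<iota>_M u_M] \<chi>_\<iota> that by (simp add: k_def)
    moreover have "u x \<otimes>\<^bsub>extension\<^esub> v \<in> ?M"
      using u_M[OF that(1)] v by (cases "u x"; cases v) auto
    then have "\<chi> (u x \<otimes>\<^bsub>extension\<^esub> v \<otimes>\<^bsub>extension\<^esub> w ?Q ?R) = k x \<otimes>\<^bsub>A\<^esub> \<chi> v \<otimes>\<^bsub>A\<^esub> \<beta> (?Q, ?R)"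
      using \<chi>_mult[OF _ w_M[OF Q]] \<chi>_mult[OF u_M[OF that(1)] v] Q by (simp add: k_def \<beta>_def)
    moreover have "\<chi> v = k y" using \<chi>_conj[OF u_M[OF that(2)] E(4)] by (simp add: v_def k_def)
    ultimately show ?thesis
      using k that \<beta>_closed[OF Q] by (simp add: A.m_comm)
  qed
  \<comment> \<open>The identity for \<open>\<beta>\<close> descends from that for
    \<open>f^n\<close>: by \<open>eq\<close> the inflation of \<open>\<beta>\<close> differs from
    \<open>f^n\<close> by a coboundary, and every coset has a representative in
    \<open>G\<close>.\<close>
  have "\<beta> \<in> cocycles2 (G Mod N) A"
    unfolding cocycles2_def
  proof (intro CollectI conjI ballI)
    show "\<beta> \<in> carrier (G Mod N) \<times> carrier (G Mod N) \<rightarrow>\<^sub>E carrier A"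
      using \<beta>_closed by (auto simp: \<beta>_def)
    fix X Y Z assume "X \<in> carrier (G Mod N)" "Y \<in> carrier (G Mod N)" "Z \<in> carrier (G Mod N)"
    then obtain x y z where xyz: "x \<in> carrier G" "y \<in> carrier G" "z \<in> carrier G"
      and XYZ: "X = N #>\<^bsub>G\<^esub> x" "Y = N #>\<^bsub>G\<^esub> y" "Z = N #>\<^bsub>G\<^esub> z" by (auto simp: carrier_FactGroup)
    define F where "F = (\<lambda>x y. f (x, y) [^]\<^bsub>A\<^esub> n)"
    define b where "b = (\<lambda>x y. \<beta> (N #>\<^bsub>G\<^esub> x, N #>\<^bsub>G\<^esub> y))"
    have cl: "F x y \<in> carrier A" "b x y \<in> carrier A" if "x \<in> carrier G" "y \<in> carrier G" for x y
      using that \<beta>_closed coset_closed by (simp_all add: F_def b_def)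
    have eq': "b x y \<otimes>\<^bsub>A\<^esub> (k x \<otimes>\<^bsub>A\<^esub> k y) = F x y \<otimes>\<^bsub>A\<^esub> k (x \<otimes>\<^bsub>G\<^esub> y)"
      if "x \<in> carrier G" "y \<in> carrier G" for x y
      using eq[OF that] by (simp add: b_def F_def)
    have F: "F y z \<otimes>\<^bsub>A\<^esub> F x (y \<otimes>\<^bsub>G\<^esub> z) = F (x \<otimes>\<^bsub>G\<^esub> y) z \<otimes>\<^bsub>A\<^esub> F x y"
      using cocycle_eq[OF xyz] xyz by (simp add: F_def flip: A.nat_pow_distrib)
    \<comment> \<open>Multiplying by \<open>?k\<close> and one more value of \<open>k\<close> pairs
      each \<open>b\<close> with the factors that \<open>eq'\<close> needs. The extra value cancels,
      and both sides of the identity meet in the same value of \<open>k\<close> at the triple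
      product.\<close>
    let ?k = "k x \<otimes>\<^bsub>A\<^esub> k y \<otimes>\<^bsub>A\<^esub> k z"
    note cl' = cl k G.m_closed A.m_closed xyz
    have "b y z \<otimes>\<^bsub>A\<^esub> b x (y \<otimes>\<^bsub>G\<^esub> z) \<otimes>\<^bsub>A\<^esub> ?k \<otimes>\<^bsub>A\<^esub> k (y \<otimes>\<^bsub>G\<^esub> z) =
        (b y z \<otimes>\<^bsub>A\<^esub> (k y \<otimes>\<^bsub>A\<^esub> k z)) \<otimes>\<^bsub>A\<^esub> (b x (y \<otimes>\<^bsub>G\<^esub> z) \<otimes>\<^bsub>A\<^esub> (k x \<otimes>\<^bsub>A\<^esub> k (y \<otimes>\<^bsub>G\<^esub> z)))"
      by (simp only: A.m_ac cl')
    also have "\<dots> = F y z \<otimes>\<^bsub>A\<^esub> F x (y \<otimes>\<^bsub>G\<^esub> z) \<otimes>\<^bsub>A\<^esub> k (x \<otimes>\<^bsub>G\<^esub> y \<otimes>\<^bsub>G\<^esub> z) \<otimes>\<^bsub>A\<^esub> k (y \<otimes>\<^bsub>G\<^esub> z)"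
      by (simp only: eq' cl' G.m_assoc) (simp only: A.m_ac cl')
    finally have 1: "b y z \<otimes>\<^bsub>A\<^esub> b x (y \<otimes>\<^bsub>G\<^esub> z) \<otimes>\<^bsub>A\<^esub> ?k =
        F y z \<otimes>\<^bsub>A\<^esub> F x (y \<otimes>\<^bsub>G\<^esub> z) \<otimes>\<^bsub>A\<^esub> k (x \<otimes>\<^bsub>G\<^esub> y \<otimes>\<^bsub>G\<^esub> z)"
      by (simp only: A.right_cancel cl')
    have "b (x \<otimes>\<^bsub>G\<^esub> y) z \<otimes>\<^bsub>A\<^esub> b x y \<otimes>\<^bsub>A\<^esub> ?k \<otimes>\<^bsub>A\<^esub> k (x \<otimes>\<^bsub>G\<^esub> y) =
        (b (x \<otimes>\<^bsub>G\<^esub> y) z \<otimes>\<^bsub>A\<^esub> (k (x \<otimes>\<^bsub>G\<^esub> y) \<otimes>\<^bsub>A\<^esub> k z)) \<otimes>\<^bsub>A\<^esub> (b x y \<otimes>\<^bsub>A\<^esub> (k x \<otimes>\<^bsub>A\<^esub> k y))"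
      by (simp only: A.m_ac cl')
    also have "\<dots> = F (x \<otimes>\<^bsub>G\<^esub> y) z \<otimes>\<^bsub>A\<^esub> F x y \<otimes>\<^bsub>A\<^esub> k (x \<otimes>\<^bsub>G\<^esub> y \<otimes>\<^bsub>G\<^esub> z) \<otimes>\<^bsub>A\<^esub> k (x \<otimes>\<^bsub>G\<^esub> y)"
      by (simp only: eq' cl') (simp only: A.m_ac cl')
    finally have 2: "b (x \<otimes>\<^bsub>G\<^esub> y) z \<otimes>\<^bsub>A\<^esub> b x y \<otimes>\<^bsub>A\<^esub> ?k =
        F (x \<otimes>\<^bsub>G\<^esub> y) z \<otimes>\<^bsub>A\<^esub> F x y \<otimes>\<^bsub>A\<^esub> k (x \<otimes>\<^bsub>G\<^esub> y \<otimes>\<^bsub>G\<^esub> z)"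
      by (simp only: A.right_cancel cl')
    have "b y z \<otimes>\<^bsub>A\<^esub> b x (y \<otimes>\<^bsub>G\<^esub> z) \<otimes>\<^bsub>A\<^esub> ?k = b (x \<otimes>\<^bsub>G\<^esub> y) z \<otimes>\<^bsub>A\<^esub> b x y \<otimes>\<^bsub>A\<^esub> ?k"
      unfolding 1 2 F ..
    then have "b y z \<otimes>\<^bsub>A\<^esub> b x (y \<otimes>\<^bsub>G\<^esub> z) = b (x \<otimes>\<^bsub>G\<^esub> y) z \<otimes>\<^bsub>A\<^esub> b x y"
      by (simp only: A.right_cancel cl')
    then show "\<beta> (Y, Z) \<otimes>\<^bsub>A\<^esub> \<beta> (X, Y \<otimes>\<^bsub>G Mod N\<^esub> Z) = \<beta> (X \<otimes>\<^bsub>G Mod N\<^esub> Y, Z) \<otimes>\<^bsub>A\<^esub> \<beta> (X, Y)"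
      unfolding XYZ using xyz by (simp only: b_def coset_mult)
  qed
  then show thesis using that[of \<beta> k] k eq by blast
qed

end

section \<open>Exponents of second cohomology groups\<close>

lemma nat_pow_product_group:
  assumes "i \<in> I"
  shows "(g [^]\<^bsub>product_group I A\<^esub> (n::nat)) i = g i [^]\<^bsub>A i\<^esub> n"
  using assms by (induction n) simp_all

lemma subgroup_cocycles2:
  assumes "group G" "comm_group A"
  shows "subgroup (cocycles2 G A) (product_group (carrier G \<times> carrier G) (\<lambda>_. A))"
    (is "subgroup _ ?P")
proof -
  interpret G: group G by fact
  interpret A: comm_group A by fact
  interpret P: group ?P by simp
  have inv: "(inv\<^bsub>?P\<^esub> f) (x, y) = inv\<^bsub>A\<^esub> f (x, y)"
    if "f \<in> cocycles2 G A" "x \<in> carrier G" "y \<in> carrier G" for f x y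
    using that by (subst inv_product_group) (auto simp: cocycles2_def)
  show ?thesis
  proof (rule P.subgroupI)
    show sub: "cocycles2 G A \<subseteq> carrier ?P" by (auto simp: cocycles2_def)
    have "\<one>\<^bsub>?P\<^esub> \<in> cocycles2 G A" by (auto simp: cocycles2_def)
    then show "cocycles2 G A \<noteq> {}" by blast
    fix f assume f: "f \<in> cocycles2 G A"
    interpret f: cocycle2 G A f using f by unfold_locales
    have "inv\<^bsub>?P\<^esub> f \<in> carrier ?P" using f sub by blast
    then show "inv\<^bsub>?P\<^esub> f \<in> cocycles2 G A"
      unfolding cocycles2_def
      by (auto simp: inv[OF f] f.cocycle_eq simp flip: A.inv_mult)
    fix g assume g: "g \<in> cocycles2 G A"
    interpret g: cocycle2 G A g using g by unfold_locales
    have "f (y, z) \<otimes>\<^bsub>A\<^esub> g (y, z) \<otimes>\<^bsub>A\<^esub> (f (x, y \<otimes>\<^bsub>G\<^esub> z) \<otimes>\<^bsub>A\<^esub> g (x, y \<otimes>\<^bsub>G\<^esub> z)) =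
        f (x \<otimes>\<^bsub>G\<^esub> y, z) \<otimes>\<^bsub>A\<^esub> g (x \<otimes>\<^bsub>G\<^esub> y, z) \<otimes>\<^bsub>A\<^esub> (f (x, y) \<otimes>\<^bsub>A\<^esub> g (x, y))" (is "?l = ?r")
      if xyz: "x \<in> carrier G" "y \<in> carrier G" "z \<in> carrier G" for x y z
    proof -
      note cl = xyz G.m_closed f.closed g.closed A.m_closed
      have "?l = (f (y, z) \<otimes>\<^bsub>A\<^esub> f (x, y \<otimes>\<^bsub>G\<^esub> z)) \<otimes>\<^bsub>A\<^esub> (g (y, z) \<otimes>\<^bsub>A\<^esub> g (x, y \<otimes>\<^bsub>G\<^esub> z))"
        by (simp only: A.m_ac cl)
      also have "\<dots> = (f (x \<otimes>\<^bsub>G\<^esub> y, z) \<otimes>\<^bsub>A\<^esub> f (x, y)) \<otimes>\<^bsub>A\<^esub> (g (x \<otimes>\<^bsub>G\<^esub> y, z) \<otimes>\<^bsub>A\<^esub> g (x, y))"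
        unfolding f.cocycle_eq[OF xyz] g.cocycle_eq[OF xyz] ..
      also have "\<dots> = ?r" by (simp only: A.m_ac cl)
      finally show ?thesis .
    qed
    then show "f \<otimes>\<^bsub>?P\<^esub> g \<in> cocycles2 G A" unfolding cocycles2_def by auto
  qed
qed

lemma subgroup_coboundaries2:
  assumes "group G" "comm_group A"
  shows "subgroup (coboundaries2 G A)
    ((product_group (carrier G \<times> carrier G) (\<lambda>_. A))\<lparr>carrier := cocycles2 G A\<rparr>)"
    (is "subgroup _ (?P\<lparr>carrier := _\<rparr>)")
proof -
  interpret G: group G by fact
  interpret A: comm_group A by fact
  interpret P: group ?P by simp
  have cob: "coboundary2 G A c \<in> cocycles2 G A" if "c \<in> carrier G \<rightarrow>\<^sub>E carrier A" for c
  proof -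
    have c: "c x \<in> carrier A" if "x \<in> carrier G" for x using that \<open>c \<in> _\<close> by auto
    have "(c z \<otimes>\<^bsub>A\<^esub> inv\<^bsub>A\<^esub> c (y \<otimes>\<^bsub>G\<^esub> z) \<otimes>\<^bsub>A\<^esub> c y) \<otimes>\<^bsub>A\<^esub>
          (c (y \<otimes>\<^bsub>G\<^esub> z) \<otimes>\<^bsub>A\<^esub> inv\<^bsub>A\<^esub> c (x \<otimes>\<^bsub>G\<^esub> (y \<otimes>\<^bsub>G\<^esub> z)) \<otimes>\<^bsub>A\<^esub> c x) =
        (c z \<otimes>\<^bsub>A\<^esub> inv\<^bsub>A\<^esub> c (x \<otimes>\<^bsub>G\<^esub> y \<otimes>\<^bsub>G\<^esub> z) \<otimes>\<^bsub>A\<^esub> c (x \<otimes>\<^bsub>G\<^esub> y)) \<otimes>\<^bsub>A\<^esub>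
          (c y \<otimes>\<^bsub>A\<^esub> inv\<^bsub>A\<^esub> c (x \<otimes>\<^bsub>G\<^esub> y) \<otimes>\<^bsub>A\<^esub> c x)" (is "?l = ?r")
      if xyz: "x \<in> carrier G" "y \<in> carrier G" "z \<in> carrier G" for x y z
    proof -
      \<comment> \<open>Both sides reduce to \<open>?m\<close> times a cancelling pair: the value of
        \<open>c\<close> at \<open>y z\<close> with its inverse on the left, the one at
        \<open>x y\<close> on the right.\<close>
      let ?m = "c x \<otimes>\<^bsub>A\<^esub> (c y \<otimes>\<^bsub>A\<^esub> (c z \<otimes>\<^bsub>A\<^esub> inv\<^bsub>A\<^esub> c (x \<otimes>\<^bsub>G\<^esub> y \<otimes>\<^bsub>G\<^esub> z)))"
      note cl = xyz G.m_closed c A.m_closed A.inv_closed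
      have "?l = (c (y \<otimes>\<^bsub>G\<^esub> z) \<otimes>\<^bsub>A\<^esub> inv\<^bsub>A\<^esub> c (y \<otimes>\<^bsub>G\<^esub> z)) \<otimes>\<^bsub>A\<^esub> ?m"
        by (simp only: A.m_ac cl G.m_assoc)
      also have "\<dots> = (c (x \<otimes>\<^bsub>G\<^esub> y) \<otimes>\<^bsub>A\<^esub> inv\<^bsub>A\<^esub> c (x \<otimes>\<^bsub>G\<^esub> y)) \<otimes>\<^bsub>A\<^esub> ?m"
        by (simp only: A.r_inv cl)
      also have "\<dots> = ?r" by (simp only: A.m_ac cl)
      finally show ?thesis .
    qed
    then show ?thesis
      using c unfolding cocycles2_def coboundary2_def by auto
  qed
  have "subgroup (coboundaries2 G A) ?P"
  proof (rule P.subgroupI)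
    show "coboundaries2 G A \<subseteq> carrier ?P"
      using cob by (auto simp: coboundaries2_def cocycles2_def)
    show "coboundaries2 G A \<noteq> {}"
      using A.one_closed by (auto simp: coboundaries2_def PiE_eq_empty_iff)
    fix f assume f: "f \<in> coboundaries2 G A"
    then obtain c where c: "f = coboundary2 G A c" "c \<in> carrier G \<rightarrow>\<^sub>E carrier A"
      by (auto simp: coboundaries2_def)
    have cA: "c x \<in> carrier A" if "x \<in> carrier G" for x using that c by auto
    have fP: "f \<in> carrier ?P" using cob c by (auto simp: cocycles2_def)
    have "inv\<^bsub>?P\<^esub> f = coboundary2 G A (\<lambda>x\<in>carrier G. inv\<^bsub>A\<^esub> c x)"
    proof -
      have "inv\<^bsub>?P\<^esub> f = (\<lambda>i\<in>carrier G \<times> carrier G. inv\<^bsub>A\<^esub> f i)"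
        using fP by (intro inv_product_group) auto
      also have "\<dots> = coboundary2 G A (\<lambda>x\<in>carrier G. inv\<^bsub>A\<^esub> c x)"
        using cA by (auto simp: c(1) coboundary2_def A.inv_mult intro!: restrict_ext)
      finally show ?thesis .
    qed
    then show "inv\<^bsub>?P\<^esub> f \<in> coboundaries2 G A" using cA by (auto simp: coboundaries2_def)
    fix g assume g: "g \<in> coboundaries2 G A"
    then obtain d where d: "g = coboundary2 G A d" "d \<in> carrier G \<rightarrow>\<^sub>E carrier A"
      by (auto simp: coboundaries2_def)
    have dA: "d x \<in> carrier A" if "x \<in> carrier G" for x using that d by auto
    have "f \<otimes>\<^bsub>?P\<^esub> g = coboundary2 G A (\<lambda>x\<in>carrier G. c x \<otimes>\<^bsub>A\<^esub> d x)"
      using cA dA by (auto simp: c(1) d(1) coboundary2_def A.inv_mult A.m_ac intro!: restrict_ext)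
    then show "f \<otimes>\<^bsub>?P\<^esub> g \<in> coboundaries2 G A" using cA dA by (auto simp: coboundaries2_def)
  qed
  moreover have "coboundaries2 G A \<subseteq> cocycles2 G A" using cob by (auto simp: coboundaries2_def)
  ultimately show ?thesis using P.subgroup_incl subgroup_cocycles2[OF assms] by blast
qed

lemma comm_group_cocycles2:
  assumes "group G" "comm_group A"
  shows "comm_group ((product_group (carrier G \<times> carrier G) (\<lambda>_. A))\<lparr>carrier := cocycles2 G A\<rparr>)"
    (is "comm_group ?C")
proof -
  interpret A: comm_group A by fact
  interpret P: group "product_group (carrier G \<times> carrier G) (\<lambda>_. A)" by simp
  interpret C: group ?C using subgroup_cocycles2[OF assms] by (rule P.subgroup_imp_group)
  show ?thesis
    by (rule C.group_comm_groupI) (auto simp: cocycles2_def intro!: restrict_ext A.m_comm)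
qed

text \<open>Turns exponents of cohomology classes into pointwise equations. The cochain
  \<open>c\<close> is allowed to be any function on the carrier, so that witnesses can be written
  down without restricting them.\<close>

lemma pow_cohomology2:
  assumes "group G" "comm_group A" and f: "f \<in> cocycles2 G A"
  defines "C \<equiv> (product_group (carrier G \<times> carrier G) (\<lambda>_. A))\<lparr>carrier := cocycles2 G A\<rparr>"
  shows "(coboundaries2 G A #>\<^bsub>C\<^esub> f) [^]\<^bsub>cohomology2 G A\<^esub> (n::nat) = \<one>\<^bsub>cohomology2 G A\<^esub> \<longleftrightarrow>
    (\<exists>c \<in> carrier G \<rightarrow> carrier A. \<forall>x\<in>carrier G. \<forall>y\<in>carrier G.
      f (x, y) [^]\<^bsub>A\<^esub> n = c y \<otimes>\<^bsub>A\<^esub> inv\<^bsub>A\<^esub> c (x \<otimes>\<^bsub>G\<^esub> y) \<otimes>\<^bsub>A\<^esub> c x)" (is "?l \<longleftrightarrow> ?r")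
proof -
  let ?P = "product_group (carrier G \<times> carrier G) (\<lambda>_. A)" and ?B = "coboundaries2 G A"
  interpret G: group G by fact
  interpret A: comm_group A by fact
  interpret P: group ?P by simp
  interpret C: comm_group C unfolding C_def by (rule comm_group_cocycles2[OF assms(1,2)])
  have B: "subgroup ?B C" unfolding C_def by (rule subgroup_coboundaries2[OF assms(1,2)])
  interpret B: normal ?B C using B by (rule C.subgroup_imp_normal)
  have H: "cohomology2 G A = C Mod ?B" by (simp add: cohomology2_def C_def)
  have fC: "f \<in> carrier C" using f by (simp add: C_def)
  have pow: "(f [^]\<^bsub>C\<^esub> n) i = f i [^]\<^bsub>A\<^esub> n" if "i \<in> carrier G \<times> carrier G" for i
    using nat_pow_product_group[OF that, where A = "\<lambda>_. A"] by (simp add: C_def flip: P.nat_pow_consistent)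
  have fn: "f [^]\<^bsub>C\<^esub> n \<in> carrier C" using fC by simp
  have "?l \<longleftrightarrow> ?B #>\<^bsub>C\<^esub> (f [^]\<^bsub>C\<^esub> n) = ?B"
    using B.FactGroup_pow[OF fC, of n] by (simp add: H)
  also have "\<dots> \<longleftrightarrow> f [^]\<^bsub>C\<^esub> n \<in> ?B"
    using C.coset_join1 C.coset_join2 B fn B.subset by blast
  also have "\<dots> \<longleftrightarrow> ?r"
  proof
    assume "f [^]\<^bsub>C\<^esub> n \<in> ?B"
    then obtain c where "f [^]\<^bsub>C\<^esub> n = coboundary2 G A c" "c \<in> carrier G \<rightarrow>\<^sub>E carrier A"
      by (auto simp: coboundaries2_def)
    then show ?r using pow by (intro bexI[of _ c]) (auto simp: coboundary2_def)
  next
    assume ?r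
    then obtain c where c: "c \<in> carrier G \<rightarrow> carrier A"
      and eq: "\<And>x y. x \<in> carrier G \<Longrightarrow> y \<in> carrier G \<Longrightarrow>
        f (x, y) [^]\<^bsub>A\<^esub> n = c y \<otimes>\<^bsub>A\<^esub> inv\<^bsub>A\<^esub> c (x \<otimes>\<^bsub>G\<^esub> y) \<otimes>\<^bsub>A\<^esub> c x" by blast
    have "f [^]\<^bsub>C\<^esub> n = coboundary2 G A (restrict c (carrier G))"
    proof (rule extensionalityI)
      show "f [^]\<^bsub>C\<^esub> n \<in> extensional (carrier G \<times> carrier G)"
        using subgroup.mem_carrier[OF subgroup_cocycles2[OF assms(1,2)], of "f [^]\<^bsub>C\<^esub> n"] fn
        by (simp add: C_def PiE_def)
    qed (use eq pow in \<open>auto simp: coboundary2_def\<close>)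
    then show "f [^]\<^bsub>C\<^esub> n \<in> ?B" using c by (auto simp: coboundaries2_def)
  qed
  finally show ?thesis .
qed

text \<open>With \<open>n\<close> the product over the lower factors, \<open>f^n\<close> is
  cohomologous to an inflated \<open>\<beta>\<close>. The power \<open>\<beta>^s\<close> is a
  coboundary on the top factor, and inflating its cochain makes \<open>f^(n s)\<close> a coboundary
  on \<open>G\<close>.\<close>

theorem group_exponent_cohomology2_dvd:
  fixes G :: "('a, 'b) monoid_scheme" and A :: "('c, 'd) monoid_scheme"
  assumes "prime p" "p > 2" "group G" "comm_group A"
    and "r \<ge> 1" and series: "subnormal_series G H r"
    and powerful: "\<And>i. i \<in> {1..r} \<Longrightarrow> powerful_p_group p (series_factor G H i)"
  shows "group_exponent (cohomology2 G A) dvd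
    (\<Prod>j=2..r. group_exponent (series_factor G H j)) *
      group_exponent (cohomology2 (series_factor G H 1) A)"
proof -
  interpret G: group G by fact
  interpret A: comm_group A by fact
  let ?Q = "series_factor G H 1"
  define n where "n = (\<Prod>j=2..r. group_exponent (series_factor G H j))"
  define s where "s = group_exponent (cohomology2 ?Q A)"
  define C where "C = (product_group (carrier G \<times> carrier G) (\<lambda>_. A))\<lparr>carrier := cocycles2 G A\<rparr>"
  have odd: "odd p" using assms(1,2) prime_odd_nat by blast
  have N: "H 1 \<lhd> G"
    using series \<open>r \<ge> 1\<close> by (auto simp: subnormal_series_def dest: bspec[of _ _ 1])
  have Q: "?Q = G Mod H 1" using series by (simp add: series_factor_def subnormal_series_def)
  have "group ?Q" unfolding Q using N by (rule normal.factorgroup_is_group)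
  interpret N: normal "H 1" G by fact
  have "\<exists>c \<in> carrier G \<rightarrow> carrier A. \<forall>x\<in>carrier G. \<forall>y\<in>carrier G.
      f (x, y) [^]\<^bsub>A\<^esub> (n * s) = c y \<otimes>\<^bsub>A\<^esub> inv\<^bsub>A\<^esub> c (x \<otimes>\<^bsub>G\<^esub> y) \<otimes>\<^bsub>A\<^esub> c x"
    if f: "f \<in> cocycles2 G A" for f
  proof -
    interpret f: cocycle2 G A f using f by unfold_locales
    interpret snd: group_hom f.extension G snd by (rule f.snd_hom)
    have "{u \<in> carrier f.extension. snd u \<in> H 1} = carrier A \<times> H 1" using N.subset by auto
    then have "(\<lambda>u. u [^]\<^bsub>f.extension\<^esub> n) \<in>
        hom (f.extension\<lparr>carrier := carrier A \<times> H 1\<rparr>) (f.extension\<lparr>carrier := carrier A \<times> {\<one>\<^bsub>G\<^esub>}\<rparr>)"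
      using snd.power_hom_subnormal_series[OF assms(1) odd f.kernel_central series powerful \<open>r \<ge> 1\<close>]
      by (simp add: f.kernel_snd n_def numeral_2_eq_2)
    then obtain \<beta> k where \<beta>: "\<beta> \<in> cocycles2 ?Q A" and k: "k \<in> carrier G \<rightarrow> carrier A"
      and \<beta>k: "\<And>x y. x \<in> carrier G \<Longrightarrow> y \<in> carrier G \<Longrightarrow>
        f (x, y) [^]\<^bsub>A\<^esub> n \<otimes>\<^bsub>A\<^esub> k (x \<otimes>\<^bsub>G\<^esub> y) = \<beta> (H 1 #>\<^bsub>G\<^esub> x, H 1 #>\<^bsub>G\<^esub> y) \<otimes>\<^bsub>A\<^esub> (k x \<otimes>\<^bsub>A\<^esub> k y)"
      using f.pow_cohomologous_inflation[OF N] unfolding Q by metis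
    have "\<exists>c \<in> carrier ?Q \<rightarrow> carrier A. \<forall>X\<in>carrier ?Q. \<forall>Y\<in>carrier ?Q.
        \<beta> (X, Y) [^]\<^bsub>A\<^esub> s = c Y \<otimes>\<^bsub>A\<^esub> inv\<^bsub>A\<^esub> c (X \<otimes>\<^bsub>?Q\<^esub> Y) \<otimes>\<^bsub>A\<^esub> c X"
      unfolding s_def pow_cohomology2[OF \<open>group ?Q\<close> assms(4) \<beta>, symmetric]
      using \<beta> by (intro pow_group_exponent) (auto simp: cohomology2_def carrier_FactGroup)
    then obtain c where c: "c \<in> carrier ?Q \<rightarrow> carrier A"
      and \<beta>c: "\<And>X Y. X \<in> carrier ?Q \<Longrightarrow> Y \<in> carrier ?Q \<Longrightarrow>
        \<beta> (X, Y) [^]\<^bsub>A\<^esub> s = c Y \<otimes>\<^bsub>A\<^esub> inv\<^bsub>A\<^esub> c (X \<otimes>\<^bsub>?Q\<^esub> Y) \<otimes>\<^bsub>A\<^esub> c X" by blast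
    \<comment> \<open>\<open>e\<close> is the inflation of \<open>c\<close>. The cochain for
      \<open>f^(n s)\<close> will be \<open>k^s e\<close>: the part \<open>k^s\<close> comes from
      replacing \<open>f^n\<close> by \<open>\<beta>\<close>, the part \<open>e\<close> from
      trivialising \<open>\<beta>^s\<close>.\<close>
    define e where "e = (\<lambda>x. c (H 1 #>\<^bsub>G\<^esub> x))"
    have coset: "H 1 #>\<^bsub>G\<^esub> x \<in> carrier ?Q" if "x \<in> carrier G" for x
      using that unfolding Q by (simp add: carrier_FactGroup)
    have eA: "e x \<in> carrier A" if "x \<in> carrier G" for x using coset[OF that] c by (auto simp: e_def)
    have kA: "k x [^]\<^bsub>A\<^esub> s \<in> carrier A" "k x \<in> carrier A" if "x \<in> carrier G" for x using k that by auto
    have "f (x, y) [^]\<^bsub>A\<^esub> (n * s) = (k y [^]\<^bsub>A\<^esub> s \<otimes>\<^bsub>A\<^esub> e y) \<otimes>\<^bsub>A\<^esub>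
        inv\<^bsub>A\<^esub> (k (x \<otimes>\<^bsub>G\<^esub> y) [^]\<^bsub>A\<^esub> s \<otimes>\<^bsub>A\<^esub> e (x \<otimes>\<^bsub>G\<^esub> y)) \<otimes>\<^bsub>A\<^esub> (k x [^]\<^bsub>A\<^esub> s \<otimes>\<^bsub>A\<^esub> e x)"
      if xy: "x \<in> carrier G" "y \<in> carrier G" for x y
    proof -
      let ?X = "H 1 #>\<^bsub>G\<^esub> x" and ?Y = "H 1 #>\<^bsub>G\<^esub> y" and ?K = "k (x \<otimes>\<^bsub>G\<^esub> y) [^]\<^bsub>A\<^esub> s"
      have xyG: "x \<otimes>\<^bsub>G\<^esub> y \<in> carrier G" using xy by simp
      have \<beta>A: "\<beta> (?X, ?Y) \<in> carrier A" using \<beta> coset xy by (auto simp: cocycles2_def)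
      have XY: "?X \<otimes>\<^bsub>?Q\<^esub> ?Y = H 1 #>\<^bsub>G\<^esub> (x \<otimes>\<^bsub>G\<^esub> y)" unfolding Q using N.rcos_sum xy by simp
      have F: "f (x, y) [^]\<^bsub>A\<^esub> (n * s) \<in> carrier A" using xy by simp
      note cl = xy xyG kA eA A.m_closed A.inv_closed
      have "f (x, y) [^]\<^bsub>A\<^esub> (n * s) \<otimes>\<^bsub>A\<^esub> ?K = (f (x, y) [^]\<^bsub>A\<^esub> n \<otimes>\<^bsub>A\<^esub> k (x \<otimes>\<^bsub>G\<^esub> y)) [^]\<^bsub>A\<^esub> s"
        using xy xyG kA by (simp add: A.nat_pow_distrib A.nat_pow_pow)
      also have "\<dots> = \<beta> (?X, ?Y) [^]\<^bsub>A\<^esub> s \<otimes>\<^bsub>A\<^esub> (k x [^]\<^bsub>A\<^esub> s \<otimes>\<^bsub>A\<^esub> k y [^]\<^bsub>A\<^esub> s)"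
        using \<beta>A kA xy by (simp add: \<beta>k A.nat_pow_distrib)
      also have "\<beta> (?X, ?Y) [^]\<^bsub>A\<^esub> s = e y \<otimes>\<^bsub>A\<^esub> inv\<^bsub>A\<^esub> e (x \<otimes>\<^bsub>G\<^esub> y) \<otimes>\<^bsub>A\<^esub> e x"
        using \<beta>c[OF coset[OF xy(1)] coset[OF xy(2)]] unfolding XY e_def .
      finally have "f (x, y) [^]\<^bsub>A\<^esub> (n * s) =
          e y \<otimes>\<^bsub>A\<^esub> inv\<^bsub>A\<^esub> e (x \<otimes>\<^bsub>G\<^esub> y) \<otimes>\<^bsub>A\<^esub> e x \<otimes>\<^bsub>A\<^esub> (k x [^]\<^bsub>A\<^esub> s \<otimes>\<^bsub>A\<^esub> k y [^]\<^bsub>A\<^esub> s) \<otimes>\<^bsub>A\<^esub> inv\<^bsub>A\<^esub> ?K"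
        using A.inv_solve_right[OF F _ kA(1)[OF xyG]] cl by simp
      also have "\<dots> = (k y [^]\<^bsub>A\<^esub> s \<otimes>\<^bsub>A\<^esub> e y) \<otimes>\<^bsub>A\<^esub>
        inv\<^bsub>A\<^esub> (?K \<otimes>\<^bsub>A\<^esub> e (x \<otimes>\<^bsub>G\<^esub> y)) \<otimes>\<^bsub>A\<^esub> (k x [^]\<^bsub>A\<^esub> s \<otimes>\<^bsub>A\<^esub> e x)"
        by (simp only: A.m_ac A.inv_mult cl)
      finally show ?thesis .
    qed
    then show ?thesis
      using eA kA by (intro bexI[of _ "\<lambda>x. k x [^]\<^bsub>A\<^esub> s \<otimes>\<^bsub>A\<^esub> e x"]) auto
  qed
  then have pow: "X [^]\<^bsub>cohomology2 G A\<^esub> (n * s) = \<one>\<^bsub>cohomology2 G A\<^esub>"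
    if "X \<in> carrier (cohomology2 G A)" for X
    using that pow_cohomology2[OF assms(3,4), of _ "n * s"]
    by (auto simp: cohomology2_def carrier_FactGroup)
  have "group (cohomology2 G A)"
    unfolding cohomology2_def
    by (intro normal.factorgroup_is_group comm_group.subgroup_imp_normal
        comm_group_cocycles2 subgroup_coboundaries2 assms)
  \<comment> \<open>A vanishing \<open>n * s\<close> is a multiple of everything; otherwise the
    exponent divides it because all \<open>n * s\<close>-th powers are trivial.\<close>
  then have "group_exponent (cohomology2 G A) dvd n * s"
    using group.group_exponent_dvd[OF _ _ pow] by (cases "n * s = 0") auto
  then show ?thesis by (simp only: n_def s_def)
qed

lemma comm_group_complex_units: "comm_group complex_units"
  by (rule comm_groupI) (auto simp: complex_units_def intro!: bexI[of _ "inverse _"])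

theorem mainTheorem8:
  fixes G :: "('a, 'b) monoid_scheme" and H :: "nat \<Rightarrow> 'a set" and p r :: nat
  assumes "prime p" and "p > 2"
    and "finite_p_group p G"
    and "r \<ge> 1" and "subnormal_series G H r"
    and "\<And>i. i \<in> {1..r} \<Longrightarrow> powerful_p_group p (series_factor G H i)"
  shows "group_exponent (schur_multiplier G) dvd
    (\<Prod>j=2..r. group_exponent (series_factor G H j)) *
      group_exponent (schur_multiplier (series_factor G H 1))"
  unfolding schur_multiplier_def
  using group_exponent_cohomology2_dvd[OF assms(1,2) _ comm_group_complex_units assms(4-6)] assms(3)
  by (simp add: finite_p_group_def)

end
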